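(* Identify $T\mathcal{N}$ with $\mathbb{H}\times\mathbb{C}$. Then: (i) the actions of $G^J(\mathbb{R})$, $\mathrm{ASp}(2,\mathbb{R})$ and $K_0\ltimes\mathbb{R}^2$ on $T\mathcal{N}$ are transitive; (ii) the isotropy subgroups of $o:=(i,0)\in\mathbb{H}\times\mathbb{C}$ relative to the actions of $G^J(\mathbb{R})$, $\mathrm{ASp}(2,\mathbb{R})$ and $K_0\ltimes\mathbb{R}^2$ are isomorphic to $\mathrm{SO}(2)\times\mathbb{R}$, $\mathrm{SO}(2)$ and the trivial group, respectively. Therefore $T\mathcal{N}$ is a homogeneous Kähler manifold and there are identifications $$T\mathcal{N}\cong G^J(\mathbb{R})/(\mathrm{SO}(2)\times\mathbb{R})\cong\mathrm{ASp}(2,\mathbb{R})/\mathrm{SO}(2)\cong K_0\ltimes\mathbb{R}^2.$$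
   Context: $\mathcal{N}$ is the manifold of Gaussian densities on $\mathbb{R}$ (mean $\mu$, deviation $\sigma$) with natural coordinates $\theta_1=\mu/\sigma^2$, $\theta_2=-1/(2\sigma^2)$. $T\mathcal{N}$ carries the Kähler structure obtained by Dombrowski's construction from the Fisher metric and the exponential connection; with $\dot\theta_i=d\theta_i$ and $z_k=\theta_k+i\dot\theta_k$, the map $(z_1,z_2)\mapsto(\tau,z)=(-iz_2,iz_1)$ identifies $T\mathcal{N}$, as a Kähler manifold, with $\mathbb{H}\times\mathbb{C}$ ($\mathbb{H}$ the upper half-plane) endowed with the metric whose matrix in the coordinates $(u,v,x,y)$ ($\tau=u+iv$, $z=x+iy$) is $$\frac12\begin{bmatrix}\frac{v+y^2}{v^3}&0&-\frac{y}{v^2}&0\\0&\frac{v+y^2}{v^3}&0&-\frac{y}{v^2}\\-\frac{y}{v^2}&0&\frac1v&0\\0&-\frac{y}{v^2}&0&\frac1v\end{bmatrix}.$$ The Jacobi group $G^J(\mathbb{R})$ is $\mathrm{SL}(2,\mathbb{R})\times\mathbb{R}^2\times\mathbb{R}$ with multiplication $(M_1,X_1,\kappa_1)\cdot(M_2,X_2,\kappa_2)=(M_1M_2,X_1M_2+X_2,\kappa_1+\kappa_2+\Omega(X_1M_2,X_2))$, where the $X_i$ are row vectors and $\Omega((\lambda_1,\mu_1),(\lambda_2,\mu_2))=\lambda_1\mu_2-\lambda_2\mu_1$. It acts on $\mathbb{H}\times\mathbb{C}$ by $\big(\big[\begin{smallmatrix}a&b\\c&d\end{smallmatrix}\big],(\lambda,\mu,\kappa)\big)\cdot(\tau,z)=\big(\frac{a\tau+b}{c\tau+d},\frac{z+\lambda\tau+\mu}{c\tau+d}\big)$.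 $\mathrm{ASp}(2,\mathbb{R})=\mathrm{SL}(2,\mathbb{R})\ltimes\mathbb{R}^2$ has multiplication $(M_1,X_1)(M_2,X_2)=(M_1M_2,X_1M_2+X_2)$ and acts by the same formula (forgetting $\kappa$). These actions are by holomorphic isometries. $K_0=\big\{\big[\begin{smallmatrix}a&b\\0&1/a\end{smallmatrix}\big]\mid a>0,\ b\in\mathbb{R}\big\}\subset\mathrm{SL}(2,\mathbb{R})$, and $K_0\ltimes\mathbb{R}^2$ is the corresponding subgroup of $\mathrm{ASp}(2,\mathbb{R})$. *)

theory Defs
  imports
    "HOL-Probability.Probability"
    "HOL-Algebra.Group_Action"
    "HOL-Algebra.Left_Coset"
    "HOL-Algebra.Elementary_Groups"
begin

section \<open>Smooth maps\<close>

text \<open>All manifolds and Lie groups below are embedded submanifolds of Euclidean spaces.  A map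
  between such sets is smooth iff it extends, locally around each point of its domain, to a
  \<open>C\<^sup>\<infinity>\<close> map on an open subset of the ambient space.\<close>

fun C_k_on :: "nat \<Rightarrow> 'a::euclidean_space set \<Rightarrow> ('a \<Rightarrow> 'b::euclidean_space) \<Rightarrow> bool" where
  "C_k_on 0 U f \<longleftrightarrow> continuous_on U f"
| "C_k_on (Suc k) U f \<longleftrightarrow>
     f differentiable_on U \<and> (\<forall>v. C_k_on k U (\<lambda>x. frechet_derivative f (at x) v))"

text \<open>Only meant for open \<open>U\<close>.\<close>

definition smooth_on :: "'a::euclidean_space set \<Rightarrow> ('a \<Rightarrow> 'b::euclidean_space) \<Rightarrow> bool" where
  "smooth_on U f \<longleftrightarrow> (\<forall>k. C_k_on k U f)"

definition smooth_map ::
    "'a::euclidean_space set \<Rightarrow> 'b::euclidean_space set \<Rightarrow> ('a \<Rightarrow> 'b) \<Rightarrow> bool" where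
  "smooth_map S T f \<longleftrightarrow> f ` S \<subseteq> T \<and>
     (\<forall>x\<in>S. \<exists>U F. open U \<and> x \<in> U \<and> smooth_on U F \<and> (\<forall>y\<in>U \<inter> S. F y = f y))"

definition diffeomorphism ::
    "'a::euclidean_space set \<Rightarrow> 'b::euclidean_space set \<Rightarrow> ('a \<Rightarrow> 'b) \<Rightarrow> bool" where
  "diffeomorphism S T f \<longleftrightarrow>
     bij_betw f S T \<and> smooth_map S T f \<and> smooth_map T S (inv_into S f)"

text \<open>Isomorphism of Lie groups.  Abstract isomorphism would be too coarse here: as abstract
  groups, \<open>SO(2) \<times> \<real>\<close> and \<open>SO(2)\<close> are isomorphic.\<close>

definition lie_isomorphic ::
    "('a::euclidean_space, 'm) monoid_scheme \<Rightarrow> ('b::euclidean_space, 'n) monoid_scheme \<Rightarrow> bool" where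
  "lie_isomorphic G H \<longleftrightarrow> (\<exists>f. f \<in> iso G H \<and> diffeomorphism (carrier G) (carrier H) f)"


section \<open>Kaehler structures on open subsets of a complex two-dimensional space\<close>

text \<open>Both manifolds of interest carry a global holomorphic chart with values in
  \<open>\<complex> \<times> \<complex>\<close>, so the complex structure is multiplication by \<open>\<i>\<close>.\<close>

definition cplx_str :: "complex \<times> complex \<Rightarrow> complex \<times> complex" where
  "cplx_str w = (\<i> * fst w, \<i> * snd w)"

type_synonym metric_field =
  "complex \<times> complex \<Rightarrow> complex \<times> complex \<Rightarrow> complex \<times> complex \<Rightarrow> real"

definition kaehler_form :: "metric_field \<Rightarrow> metric_field" where
  "kaehler_form g p v w = g p (cplx_str v) w"

text \<open>The last condition is \<open>d\<omega> = 0\<close>, evaluated on constant vector fields.\<close>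

definition kaehler :: "(complex \<times> complex) set \<Rightarrow> metric_field \<Rightarrow> bool" where
  "kaehler D g \<longleftrightarrow>
     open D \<and>
     (\<forall>v w. smooth_on D (\<lambda>p. g p v w)) \<and>
     (\<forall>p\<in>D. bilinear (g p) \<and> (\<forall>v w. g p v w = g p w v) \<and> (\<forall>v. v \<noteq> 0 \<longrightarrow> 0 < g p v v) \<and>
        (\<forall>v w. g p (cplx_str v) (cplx_str w) = g p v w)) \<and>
     (\<forall>p\<in>D. \<forall>u v w.
        frechet_derivative (\<lambda>q. kaehler_form g q v w) (at p) u
      + frechet_derivative (\<lambda>q. kaehler_form g q w u) (at p) v
      + frechet_derivative (\<lambda>q. kaehler_form g q u v) (at p) w = 0)"

text \<open>Holomorphic isometric diffeomorphisms.\<close>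

definition kaehler_iso ::
    "(complex \<times> complex) set \<Rightarrow> metric_field \<Rightarrow> (complex \<times> complex) set \<Rightarrow> metric_field \<Rightarrow>
     (complex \<times> complex \<Rightarrow> complex \<times> complex) \<Rightarrow> bool" where
  "kaehler_iso D g D' g' f \<longleftrightarrow>
     diffeomorphism D D' f \<and>
     (\<forall>p\<in>D. let L = frechet_derivative f (at p) in
        (\<forall>v. L (cplx_str v) = cplx_str (L v)) \<and> (\<forall>v w. g' (f p) (L v) (L w) = g p v w))"

definition homogeneous_kaehler :: "(complex \<times> complex) set \<Rightarrow> metric_field \<Rightarrow> bool" where
  "homogeneous_kaehler D g \<longleftrightarrow>
     kaehler D g \<and> (\<forall>p\<in>D. \<forall>q\<in>D. \<exists>f. kaehler_iso D g D g f \<and> f p = q)"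


section \<open>The tangent bundle of the manifold of Gaussian densities\<close>

definition natural_coords :: "real \<Rightarrow> real \<Rightarrow> real \<times> real" where
  "natural_coords \<mu> \<sigma> = (\<mu> / \<sigma>\<^sup>2, - 1 / (2 * \<sigma>\<^sup>2))"

definition natural_domain :: "(real \<times> real) set" where
  "natural_domain = {natural_coords \<mu> \<sigma> | \<mu> \<sigma>. 0 < \<sigma>}"

definition gauss :: "real \<times> real \<Rightarrow> real \<Rightarrow> real" where
  "gauss \<theta> = normal_density (- fst \<theta> / (2 * snd \<theta>)) (sqrt (- 1 / (2 * snd \<theta>)))"

lemma gauss_natural_coords:
  "0 < \<sigma> \<Longrightarrow> gauss (natural_coords \<mu> \<sigma>) = normal_density \<mu> \<sigma>"
  by (simp add: gauss_def natural_coords_def real_sqrt_divide)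

definition score :: "real \<times> real \<Rightarrow> real \<times> real \<Rightarrow> real \<Rightarrow> real" where
  "score \<theta> v x = frechet_derivative (\<lambda>\<eta>. ln (gauss \<eta> x)) (at \<theta>) v"

definition fisher :: "real \<times> real \<Rightarrow> real \<times> real \<Rightarrow> real \<times> real \<Rightarrow> real" where
  "fisher \<theta> v w = (LINT x|lborel. score \<theta> v x * score \<theta> w x * gauss \<theta> x)"

text \<open>A tangent vector with coordinates \<open>(\<theta>\<^sub>1, \<theta>\<^sub>2, \<theta>\<^sub>1', \<theta>\<^sub>2')\<close>, where \<open>\<theta>\<^sub>k' = d\<theta>\<^sub>k\<close>, is represented
  by \<open>(z\<^sub>1, z\<^sub>2)\<close> with \<open>z\<^sub>k = \<theta>\<^sub>k + \<i> \<theta>\<^sub>k'\<close>.  The natural coordinates are affine for the exponential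
  connection, so its horizontal and vertical distributions are spanned by the
  \<open>\<partial>/\<partial>\<theta>\<^sub>k\<close> and by the \<open>\<partial>/\<partial>\<theta>\<^sub>k'\<close>.  Dombrowski's complex structure sends
  \<open>\<partial>/\<partial>\<theta>\<^sub>k\<close> to \<open>\<partial>/\<partial>\<theta>\<^sub>k'\<close>, that is, it is \<^const>\<open>cplx_str\<close>, and Dombrowski's metric is the orthogonal
  sum of two copies of the Fisher metric.\<close>

definition TN :: "(complex \<times> complex) set" where
  "TN = {(z1, z2). (Re z1, Re z2) \<in> natural_domain}"

definition TN_metric :: metric_field where
  "TN_metric p v w =
     (let \<theta> = (Re (fst p), Re (snd p)) in
        fisher \<theta> (Re (fst v), Re (snd v)) (Re (fst w), Re (snd w))
      + fisher \<theta> (Im (fst v), Im (snd v)) (Im (fst w), Im (snd w)))"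


section \<open>The Siegel-Jacobi space\<close>

definition HC :: "(complex \<times> complex) set" where
  "HC = {(\<tau>, z). 0 < Im \<tau>}"

definition HC_matrix :: "complex \<times> complex \<Rightarrow> real^4^4" where
  "HC_matrix p = (let v = Im (fst p); y = Im (snd p) in
     (1/2) *\<^sub>R vector
       [vector [(v + y\<^sup>2) / v^3, 0,              - (y / v\<^sup>2), 0           ],
        vector [0,              (v + y\<^sup>2) / v^3, 0,           - (y / v\<^sup>2)],
        vector [- (y / v\<^sup>2),    0,              1 / v,       0           ],
        vector [0,              - (y / v\<^sup>2),    0,           1 / v       ]])"

text \<open>Components of a tangent vector in the coordinates \<open>(u, v, x, y)\<close>, where
  \<open>\<tau> = u + \<i> v\<close> and \<open>z = x + \<i> y\<close>.\<close>

definition real_components :: "complex \<times> complex \<Rightarrow> real^4" where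
  "real_components w = vector [Re (fst w), Im (fst w), Re (snd w), Im (snd w)]"

definition HC_metric :: metric_field where
  "HC_metric p v w = real_components v \<bullet> (HC_matrix p *v real_components w)"

definition TN_to_HC :: "complex \<times> complex \<Rightarrow> complex \<times> complex" where
  "TN_to_HC = (\<lambda>(z1, z2). (- \<i> * z2, \<i> * z1))"

definition base_point :: "complex \<times> complex" where
  "base_point = (\<i>, 0)"


section \<open>The groups and their actions\<close>

definition SL2 :: "(real^2^2) set" where
  "SL2 = {M. det M = 1}"

definition Omega :: "real^2 \<Rightarrow> real^2 \<Rightarrow> real" where
  "Omega X Y = X$1 * Y$2 - X$2 * Y$1"

definition jacobi_group :: "((real^2^2) \<times> (real^2) \<times> real) monoid" where
  "jacobi_group =
    \<lparr>carrier = SL2 \<times> UNIV \<times> UNIV,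
     mult = (\<lambda>(M1, X1, k1) (M2, X2, k2). (M1 ** M2, X1 v* M2 + X2, k1 + k2 + Omega (X1 v* M2) X2)),
     one = (mat 1, 0, 0)\<rparr>"

definition ASp2 :: "((real^2^2) \<times> (real^2)) monoid" where
  "ASp2 =
    \<lparr>carrier = SL2 \<times> UNIV,
     mult = (\<lambda>(M1, X1) (M2, X2). (M1 ** M2, X1 v* M2 + X2)),
     one = (mat 1, 0)\<rparr>"

definition K0 :: "(real^2^2) set" where
  "K0 = {vector [vector [a, b], vector [0, 1 / a]] | a b. 0 < a}"

definition K0_affine :: "((real^2^2) \<times> (real^2)) monoid" where
  "K0_affine = ASp2\<lparr>carrier := K0 \<times> UNIV\<rparr>"

definition SO2 :: "(real^2^2) monoid" where
  "SO2 = \<lparr>carrier = {M. rotation_matrix M}, mult = (**), one = mat 1\<rparr>"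

definition real_add_group :: "real monoid" where
  "real_add_group = \<lparr>carrier = UNIV, mult = (+), one = 0\<rparr>"

definition affine_moebius ::
    "(real^2^2) \<times> (real^2) \<Rightarrow> complex \<times> complex \<Rightarrow> complex \<times> complex" where
  "affine_moebius = (\<lambda>(M, X) (\<tau>, z).
     ((of_real (M$1$1) * \<tau> + of_real (M$1$2)) / (of_real (M$2$1) * \<tau> + of_real (M$2$2)),
      (z + of_real (X$1) * \<tau> + of_real (X$2)) / (of_real (M$2$1) * \<tau> + of_real (M$2$2))))"

text \<open>The restriction to \<^const>\<open>HC\<close> is required by \<^locale>\<open>group_action\<close>, whose bijections are extensional.\<close>

definition ASp2_action :: "(real^2^2) \<times> (real^2) \<Rightarrow> complex \<times> complex \<Rightarrow> complex \<times> complex" where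
  "ASp2_action g = restrict (affine_moebius g) HC"

definition jacobi_action ::
    "(real^2^2) \<times> (real^2) \<times> real \<Rightarrow> complex \<times> complex \<Rightarrow> complex \<times> complex" where
  "jacobi_action = (\<lambda>(M, X, k). ASp2_action (M, X))"

definition isotropy_group ::
    "('g, 'm) monoid_scheme \<Rightarrow> ('g \<Rightarrow> 'a \<Rightarrow> 'a) \<Rightarrow> 'a \<Rightarrow> ('g, 'm) monoid_scheme" where
  "isotropy_group G \<phi> p = G\<lparr>carrier := stabilizer G \<phi> p\<rparr>"


section \<open>Identifications with homogeneous spaces\<close>

text \<open>An equivariant diffeomorphism \<open>F\<close> from \<open>G/H\<close> (left cosets) onto \<open>M\<close> that sends the coset \<open>H\<close> to
  \<open>p\<close>.  The smooth structure of \<open>G/H\<close> is the one that makes the projection from \<open>G\<close> a smooth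
  submersion; so \<open>F\<close> is smooth iff its composition with the projection is, and the
  inverse of \<open>F\<close> is smooth iff it lifts locally to smooth maps into \<open>G\<close>.\<close>

definition quotient_identification ::
    "('g::euclidean_space, 'm) monoid_scheme \<Rightarrow> 'g set \<Rightarrow> ('g \<Rightarrow> 'a \<Rightarrow> 'a) \<Rightarrow>
     'a::euclidean_space set \<Rightarrow> 'a \<Rightarrow> ('g set \<Rightarrow> 'a) \<Rightarrow> bool" where
  "quotient_identification G H \<phi> M p F \<longleftrightarrow>
     bij_betw F (lcosets\<^bsub>G\<^esub> H) M \<and>
     F H = p \<and>
     (\<forall>g\<in>carrier G. \<forall>C\<in>lcosets\<^bsub>G\<^esub> H. F (g <#\<^bsub>G\<^esub> C) = \<phi> g (F C)) \<and>
     smooth_map (carrier G) M (\<lambda>g. F (g <#\<^bsub>G\<^esub> H)) \<and>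
     (\<forall>q\<in>M. \<exists>U s. open U \<and> q \<in> U \<and> smooth_map (M \<inter> U) (carrier G) s \<and>
        (\<forall>r\<in>M \<inter> U. F (s r <#\<^bsub>G\<^esub> H) = r))"

definition group_identification ::
    "('g::euclidean_space, 'm) monoid_scheme \<Rightarrow> ('g \<Rightarrow> 'a \<Rightarrow> 'a) \<Rightarrow>
     'a::euclidean_space set \<Rightarrow> 'a \<Rightarrow> ('g \<Rightarrow> 'a) \<Rightarrow> bool" where
  "group_identification G \<phi> M p F \<longleftrightarrow>
     diffeomorphism (carrier G) M F \<and>
     F \<one>\<^bsub>G\<^esub> = p \<and>
     (\<forall>g\<in>carrier G. \<forall>h\<in>carrier G. F (g \<otimes>\<^bsub>G\<^esub> h) = \<phi> g (F h))"

end

(* Writing s = -1/(2 theta_2) for the variance, the Gaussian moments turn the Fisher metric into the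
   Hessian of the log-partition function, whose third derivatives are symmetric; this symmetry is the
   closedness of the Kaehler form.

   The group K_0 |x R^2 acts simply transitively on H x C, with explicit smooth inverse
   (tau, z) |-> ([[r, u/r], [0, 1/r]], (y/r, x/r)), r = sqrt v, of the orbit map at (i, 0).
   This one section gives all transitivity claims and the smooth sections of the larger groups.
   In the chart (z_1, z_2) the elements of K_0 |x R^2 are complex affine maps, so that the
   homogeneity of TN reduces to an algebraic identity. *)

theory Submission
  imports Defs
begin

text \<open>\<open>smooth_on\<close> is a recursion through \<open>frechet_derivative\<close>, so a
  small calculus has to come first. Every map below is built from linear maps, products, quotients
  and a square root; closure under these suffices and no general composition rule is used. Elements
  of \<open>K0\<close> are upper triangular, so their automorphy factor is constant: this is why
  they act by affine maps. Writing these out in the chart of \<open>TN\<close>, instead of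
  conjugating the action on \<open>HC\<close> by \<open>TN_to_HC\<close>, keeps the derivatives
  constant. With \<open>s\<close> the variance and \<open>P = Re (fst p)\<close>, the metric
  coefficients are polynomials in \<open>s\<close> and \<open>P\<close>. The complex structure
  enters only through the products \<open>Re (a * cnj b)\<close>, which do not change when both
  factors are multiplied by \<open>\<i>\<close>; compatibility of metric and complex structure is
  then immediate. In these variables \<open>TN_to_HC\<close> reads
  \<open>Im \<tau> = 1 / (2 * s)\<close>, \<open>Im z = P\<close>.\<close>

section \<open>Calculus of smooth maps\<close>

lemma C_k_on_Suc_has_derivative:
  assumes "C_k_on (Suc k) U f" "open U" "x \<in> U"
  shows "(f has_derivative frechet_derivative f (at x)) (at x)"
  using assms by (auto simp: differentiable_on_eq_differentiable_at frechet_derivative_works)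

text \<open>Since \<open>U\<close> is open, the derivative at a point of \<open>U\<close> depends
  only on the values on \<open>U\<close>, so agreement passes down the recursion.\<close>

lemma C_k_on_cong:
  assumes "C_k_on k U f" "open U" "\<And>x. x \<in> U \<Longrightarrow> f x = g x"
  shows "C_k_on k U g"
  using assms
proof (induction k arbitrary: f g)
  case 0
  then show ?case by (simp cong: continuous_on_cong)
next
  case (Suc k)
  have d: "(g has_derivative frechet_derivative f (at x)) (at x)" if "x \<in> U" for x
    using C_k_on_Suc_has_derivative[OF Suc.prems(1,2) that] Suc.prems(2) that Suc.prems(3)
    by (rule has_derivative_transform_within_open)
  then have "g differentiable_on U"
    by (meson differentiable_at_imp_differentiable_on differentiable_def)
  moreover have "C_k_on k U (\<lambda>x. frechet_derivative g (at x) v)" for v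
    by (rule Suc.IH[of "\<lambda>x. frechet_derivative f (at x) v"])
      (use Suc.prems frechet_derivative_at[OF d] in auto)
  ultimately show ?case by simp
qed

text \<open>Lets an explicit derivative stand in for the choice operator
  \<open>frechet_derivative\<close>; the closure rules below go through this.\<close>

lemma C_k_on_SucI:
  assumes "open U" "\<And>x. x \<in> U \<Longrightarrow> (f has_derivative f' x) (at x)"
    and "\<And>v. C_k_on k U (\<lambda>x. f' x v)"
  shows "C_k_on (Suc k) U f"
proof -
  have "f differentiable_on U"
    using assms(2) by (meson differentiable_at_imp_differentiable_on differentiable_def)
  moreover have "C_k_on k U (\<lambda>x. frechet_derivative f (at x) v)" for v
    by (rule C_k_on_cong[OF assms(3)[of v] assms(1)]) (simp add: frechet_derivative_at[OF assms(2)])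
  ultimately show ?thesis by simp
qed

text \<open>The recursion does not list the lower orders. Differentiability supplies continuity at
  order 0, and above it the claim passes to the directional derivatives.\<close>

lemma C_k_on_SucD: "\<lbrakk>C_k_on (Suc k) U f; open U\<rbrakk> \<Longrightarrow> C_k_on k U f"
proof (induction k arbitrary: f)
  case 0
  then show ?case by (simp add: differentiable_imp_continuous_on)
next
  case (Suc k)
  then have "f differentiable_on U" "C_k_on (Suc k) U (\<lambda>x. frechet_derivative f (at x) v)" for v
    unfolding C_k_on.simps(2)[of "Suc k"] by blast+
  with Suc.IH Suc.prems(2) show ?case by simp
qed

lemma C_k_on_const: "open U \<Longrightarrow> C_k_on k U (\<lambda>x. c)"
proof (induction k arbitrary: c)
  case (Suc k)
  show ?case
    by (rule C_k_on_SucI[OF Suc.prems has_derivative_const Suc.IH[OF Suc.prems]])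
qed simp

lemma C_k_on_linear_comp:
  assumes "bounded_linear L" "C_k_on k U f" "open U"
  shows "C_k_on k U (\<lambda>x. L (f x))"
  using assms(2)
proof (induction k arbitrary: f)
  case 0
  then show ?case using assms(1) by (simp add: bounded_linear.continuous_on)
next
  case (Suc k)
  show ?case
    using Suc.prems
    by (intro C_k_on_SucI[OF assms(3) bounded_linear.has_derivative[OF assms(1)
            C_k_on_Suc_has_derivative[OF Suc.prems assms(3)]]] Suc.IH) auto
qed

lemma C_k_on_add:
  assumes "C_k_on k U f" "C_k_on k U g" "open U"
  shows "C_k_on k U (\<lambda>x. f x + g x)"
  using assms(1,2)
proof (induction k arbitrary: f g)
  case 0
  then show ?case by (simp add: continuous_on_add)
next
  case (Suc k)
  show ?case
    using Suc.prems
    by (intro C_k_on_SucI[OF assms(3) has_derivative_add[OF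
            C_k_on_Suc_has_derivative[OF Suc.prems(1) assms(3)]
            C_k_on_Suc_has_derivative[OF Suc.prems(2) assms(3)]]] Suc.IH) auto
qed

lemma C_k_on_bilinear:
  assumes B: "bounded_bilinear B" and "C_k_on k U f" "C_k_on k U g" "open U"
  shows "C_k_on k U (\<lambda>x. B (f x) (g x))"
  using assms(2,3)
proof (induction k arbitrary: f g)
  case 0
  then show ?case using bounded_bilinear.continuous_on[OF B] by simp
next
  case (Suc k)
  note d = C_k_on_Suc_has_derivative[OF Suc.prems(1) \<open>open U\<close>]
    C_k_on_Suc_has_derivative[OF Suc.prems(2) \<open>open U\<close>]
  have "C_k_on k U (\<lambda>x. B (f x) (frechet_derivative g (at x) v) + B (frechet_derivative f (at x) v) (g x))" for v
    using Suc.prems C_k_on_SucD[OF Suc.prems(1) \<open>open U\<close>] C_k_on_SucD[OF Suc.prems(2) \<open>open U\<close>] \<open>open U\<close>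
    by (intro C_k_on_add Suc.IH) auto
  from C_k_on_SucI[OF \<open>open U\<close> bounded_bilinear.FDERIV[OF B d] this] show ?case .
qed

text \<open>The derivative contains \<open>inverse (f x)\<close> again, so the induction keeps
  \<open>f\<close> fixed and feeds order \<open>k\<close> of the same function into order
  \<open>Suc k\<close>. The square root below works in the same way.\<close>

lemma C_k_on_inverse:
  fixes f :: "'a::euclidean_space \<Rightarrow> 'b::{euclidean_space, real_normed_field}"
  assumes "C_k_on k U f" "open U" and nz: "\<And>x. x \<in> U \<Longrightarrow> f x \<noteq> 0"
  shows "C_k_on k U (\<lambda>x. inverse (f x))"
  using assms(1)
proof (induction k)
  case 0
  then show ?case using nz by (auto intro!: continuous_on_inverse)
next
  case (Suc k)
  have inv: "C_k_on k U (\<lambda>x. inverse (f x))"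
    by (rule Suc.IH[OF C_k_on_SucD[OF Suc.prems assms(2)]])
  have "C_k_on k U (\<lambda>x. - (inverse (f x) * frechet_derivative f (at x) v * inverse (f x)))" for v
    using Suc.prems \<open>open U\<close> inv
    by (intro C_k_on_linear_comp[of uminus] C_k_on_bilinear[OF bounded_bilinear_mult])
      (auto intro: bounded_linear_minus[OF bounded_linear_ident])
  from C_k_on_SucI[OF \<open>open U\<close> Deriv.has_derivative_inverse[OF nz
      C_k_on_Suc_has_derivative[OF Suc.prems \<open>open U\<close>]] this] show ?case .
qed

lemma C_k_on_sqrt:
  fixes f :: "'a::euclidean_space \<Rightarrow> real"
  assumes "C_k_on k U f" "open U" and pos: "\<And>x. x \<in> U \<Longrightarrow> 0 < f x"
  shows "C_k_on k U (\<lambda>x. sqrt (f x))"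
  using assms(1)
proof (induction k)
  case 0
  then show ?case by (simp add: continuous_on_real_sqrt)
next
  case (Suc k)
  have s: "C_k_on k U (\<lambda>x. sqrt (f x))"
    by (rule Suc.IH[OF C_k_on_SucD[OF Suc.prems assms(2)]])
  have "bounded_linear ((*) (2::real))"
    by (rule bounded_linear_mult_right)
  from C_k_on_linear_comp[OF this s \<open>open U\<close>]
  have "C_k_on k U (\<lambda>x. inverse (2 * sqrt (f x)))"
    by (rule C_k_on_inverse[OF _ \<open>open U\<close>]) (use pos in force)
  then have *: "C_k_on k U (\<lambda>x. frechet_derivative f (at x) v * inverse (2 * sqrt (f x)))" for v
    using Suc.prems by (intro C_k_on_bilinear[OF bounded_bilinear_mult _ _ \<open>open U\<close>]) simp_all
  have "((\<lambda>x. sqrt (f x)) has_derivative (\<lambda>v. frechet_derivative f (at x) v * inverse (2 * sqrt (f x)))) (at x)"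
    if "x \<in> U" for x
    using has_derivative_compose[OF C_k_on_Suc_has_derivative[OF Suc.prems \<open>open U\<close> that]
        DERIV_real_sqrt[OF pos[OF that], unfolded has_field_derivative_def]]
    by (simp add: field_simps)
  from C_k_on_SucI[OF \<open>open U\<close> this *] show ?case .
qed

lemma C_k_on_subset: "\<lbrakk>C_k_on k U f; V \<subseteq> U\<rbrakk> \<Longrightarrow> C_k_on k V f"
proof (induction k arbitrary: f)
  case 0
  then show ?case using continuous_on_subset by auto
next
  case (Suc k)
  then show ?case using differentiable_on_subset by auto
qed

section \<open>Closure rules for smooth functions\<close>

named_theorems smooth_intros

lemma smooth_on_cong: "\<lbrakk>smooth_on U f; open U; \<And>x. x \<in> U \<Longrightarrow> f x = g x\<rbrakk> \<Longrightarrow> smooth_on U g"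
  unfolding smooth_on_def using C_k_on_cong by blast

lemma smooth_on_subset: "\<lbrakk>smooth_on U f; open V; V \<subseteq> U\<rbrakk> \<Longrightarrow> smooth_on V f"
  unfolding smooth_on_def using C_k_on_subset by blast

lemma smooth_on_const [smooth_intros]: "open U \<Longrightarrow> smooth_on U (\<lambda>x. c)"
  by (simp add: smooth_on_def C_k_on_const)

lemma smooth_on_linear_comp:
  "\<lbrakk>bounded_linear L; smooth_on U f; open U\<rbrakk> \<Longrightarrow> smooth_on U (\<lambda>x. L (f x))"
  by (simp add: smooth_on_def C_k_on_linear_comp)

lemma smooth_on_ident [smooth_intros]:
  assumes "open U" shows "smooth_on U (\<lambda>x. x)"
proof -
  have "C_k_on k U (\<lambda>x. x)" for k
  proof (cases k)
    case (Suc m)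
    show ?thesis unfolding Suc
      by (rule C_k_on_SucI[where f' = "\<lambda>_ v. v"]) (use assms C_k_on_const in auto)
  qed simp
  then show ?thesis by (simp add: smooth_on_def)
qed

lemma smooth_on_add [smooth_intros]:
  "\<lbrakk>smooth_on U f; smooth_on U g; open U\<rbrakk> \<Longrightarrow> smooth_on U (\<lambda>x. f x + g x)"
  by (simp add: smooth_on_def C_k_on_add)

lemma smooth_on_uminus [smooth_intros]:
  "\<lbrakk>smooth_on U f; open U\<rbrakk> \<Longrightarrow> smooth_on U (\<lambda>x. - f x)"
  by (rule smooth_on_linear_comp[OF bounded_linear_minus[OF bounded_linear_ident]])

lemma smooth_on_diff [smooth_intros]:
  "\<lbrakk>smooth_on U f; smooth_on U g; open U\<rbrakk> \<Longrightarrow> smooth_on U (\<lambda>x. f x - g x)"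
  using smooth_on_add[of U f "\<lambda>x. - g x"] smooth_on_uminus[of U g] by simp

lemma smooth_on_sum [smooth_intros]:
  assumes "\<And>i. i \<in> I \<Longrightarrow> smooth_on U (f i)" "open U"
  shows "smooth_on U (\<lambda>x. \<Sum>i\<in>I. f i x)"
  using assms by (induction I rule: infinite_finite_induct) (auto intro: smooth_on_const smooth_on_add)

lemma smooth_on_mult [smooth_intros]:
  fixes f :: "'a::euclidean_space \<Rightarrow> 'b::{euclidean_space, real_normed_algebra}"
  shows "\<lbrakk>smooth_on U f; smooth_on U g; open U\<rbrakk> \<Longrightarrow> smooth_on U (\<lambda>x. f x * g x)"
  by (simp add: smooth_on_def C_k_on_bilinear[OF bounded_bilinear_mult])

lemma smooth_on_power [smooth_intros]:
  fixes f :: "'a::euclidean_space \<Rightarrow> 'b::{euclidean_space, real_normed_algebra_1}"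
  shows "\<lbrakk>smooth_on U f; open U\<rbrakk> \<Longrightarrow> smooth_on U (\<lambda>x. f x ^ n)"
  by (induction n) (auto intro: smooth_on_const smooth_on_mult)

lemma smooth_on_divide [smooth_intros]:
  fixes f :: "'a::euclidean_space \<Rightarrow> 'b::{euclidean_space, real_normed_field}"
  shows "\<lbrakk>smooth_on U f; smooth_on U g; open U; \<And>x. x \<in> U \<Longrightarrow> g x \<noteq> 0\<rbrakk> \<Longrightarrow> smooth_on U (\<lambda>x. f x / g x)"
  unfolding divide_inverse
  by (simp add: smooth_on_def C_k_on_bilinear[OF bounded_bilinear_mult] C_k_on_inverse)

lemma smooth_on_sqrt [smooth_intros]:
  fixes f :: "'a::euclidean_space \<Rightarrow> real"
  shows "\<lbrakk>smooth_on U f; open U; \<And>x. x \<in> U \<Longrightarrow> 0 < f x\<rbrakk> \<Longrightarrow> smooth_on U (\<lambda>x. sqrt (f x))"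
  by (simp add: smooth_on_def C_k_on_sqrt)

lemmas smooth_on_components [smooth_intros] =
  smooth_on_linear_comp[OF bounded_linear_fst] smooth_on_linear_comp[OF bounded_linear_snd]
  smooth_on_linear_comp[OF bounded_linear_Re] smooth_on_linear_comp[OF bounded_linear_Im]
  smooth_on_linear_comp[OF bounded_linear_vec_nth]

lemma smooth_on_complex_of_real [smooth_intros]:
  "\<lbrakk>smooth_on U f; open U\<rbrakk> \<Longrightarrow> smooth_on U (\<lambda>x. complex_of_real (f x))"
  by (rule smooth_on_linear_comp[OF bounded_linear_of_real])

text \<open>A pair is a sum of images under two linear injections; \<open>smooth_on_vec\<close> does
  the same with the coordinate axes.\<close>

lemma smooth_on_Pair [smooth_intros]:
  assumes "smooth_on U f" "smooth_on U g" "open U"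
  shows "smooth_on U (\<lambda>x. (f x, g x))"
proof -
  have "smooth_on U (\<lambda>x. (f x, 0) + (0, g x))"
    using assms
    by (intro smooth_on_add smooth_on_linear_comp[of "\<lambda>a. (a, 0)"] smooth_on_linear_comp[of "\<lambda>b. (0, b)"])
      (simp_all add: bounded_linear_Pair bounded_linear_ident bounded_linear_zero)
  then show ?thesis by simp
qed

lemma smooth_on_vec:
  fixes f :: "'a::euclidean_space \<Rightarrow> 'b::euclidean_space ^ 'n"
  assumes "\<And>i. smooth_on U (\<lambda>x. f x $ i)" "open U"
  shows "smooth_on U f"
proof -
  have L: "bounded_linear (\<lambda>a::'b. axis i a)" for i :: 'n
    by (simp add: linear_conv_bounded_linear[symmetric] linear_iff vec_eq_iff axis_def)
  have "smooth_on U (\<lambda>x. \<Sum>i\<in>UNIV. axis i (f x $ i))"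
    using assms by (intro smooth_on_sum smooth_on_linear_comp[OF L]) auto
  moreover have "(\<Sum>i\<in>UNIV. axis i (f x $ i)) = f x" for x
    by (simp add: vec_eq_iff axis_def if_distrib sum.delta' cong: if_cong)
  ultimately show ?thesis by simp
qed

lemma smooth_on_vector2 [smooth_intros]:
  fixes f :: "'a::euclidean_space \<Rightarrow> 'b::euclidean_space"
  assumes "smooth_on U f" "smooth_on U g" "open U"
  shows "smooth_on U (\<lambda>x. vector [f x, g x] :: 'b^2)"
proof (rule smooth_on_vec)
  show "smooth_on U (\<lambda>x. (vector [f x, g x] :: 'b^2) $ i)" for i
    using exhaust_2[of i] assms by auto
qed (rule assms)

text \<open>One extension around all of \<open>S\<close> replaces the pointwise choice of
  extensions; every map below has one.\<close>

lemma smooth_mapI: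
  assumes "f ` S \<subseteq> T" "open U" "S \<subseteq> U" "smooth_on U F" "\<And>x. x \<in> S \<Longrightarrow> F x = f x"
  shows "smooth_map S T f"
  using assms unfolding smooth_map_def by blast

lemma diffeomorphismI:
  assumes "smooth_map S T f" "smooth_map T S g"
    and "\<And>x. x \<in> S \<Longrightarrow> g (f x) = x" "\<And>y. y \<in> T \<Longrightarrow> f (g y) = y"
  shows "diffeomorphism S T f"
proof -
  have bij: "bij_betw f S T"
    using assms by (intro bij_betw_byWitness[where f' = g]) (auto simp: smooth_map_def)
  have "inv_into S f y = g y" if "y \<in> T" for y
    using bij that assms
    by (metis bij_betw_imp_inj_on image_subset_iff inv_into_f_eq smooth_map_def)
  then have "smooth_map T S (inv_into S f)"
    using assms(2) unfolding smooth_map_def image_subset_iff by (metis IntE)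
  with bij assms(1) show ?thesis by (simp add: diffeomorphism_def)
qed

section \<open>The Fisher metric in natural coordinates\<close>

lemma natural_domain_eq: "natural_domain = {\<theta>. snd \<theta> < 0}"
proof (intro equalityI subsetI)
  fix \<theta> :: "real \<times> real" assume "\<theta> \<in> {\<theta>. snd \<theta> < 0}"
  then have "\<theta> = natural_coords (- fst \<theta> / (2 * snd \<theta>)) (sqrt (- 1 / (2 * snd \<theta>)))"
    "0 < sqrt (- 1 / (2 * snd \<theta>))"
    by (auto simp: natural_coords_def prod_eq_iff field_simps)
  then show "\<theta> \<in> natural_domain" unfolding natural_domain_def by blast
qed (auto simp: natural_domain_def natural_coords_def)

text \<open>Completing the square gives the exponential family form: the sufficient statistics are
  \<open>x\<close> and \<open>x^2\<close>, and the last two summands are minus the log-partition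
  function.\<close>

lemma ln_gauss:
  assumes "snd \<theta> < 0"
  shows "ln (gauss \<theta> x) =
    fst \<theta> * x + snd \<theta> * x\<^sup>2 + (fst \<theta>)\<^sup>2 / (4 * snd \<theta>) + ln (- snd \<theta> / pi) / 2"
proof -
  define Q where "Q = snd \<theta>"
  have Q: "Q < 0" using assms by (simp add: Q_def)
  have pos: "0 < - Q / pi" using Q by (simp add: divide_neg_pos)
  have "gauss \<theta> x = sqrt (- Q / pi) * exp (- (x + fst \<theta> / (2 * Q))\<^sup>2 / (- 1 / Q))"
  proof -
    have "2 * pi * (sqrt (- 1 / (2 * Q)))\<^sup>2 = inverse (- Q / pi)"
      using Q by (simp add: divide_simps)
    then have "1 / sqrt (2 * pi * (sqrt (- 1 / (2 * Q)))\<^sup>2) = sqrt (- Q / pi)"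
      by (simp only: real_sqrt_inverse divide_inverse) simp
    moreover have "2 * (sqrt (- 1 / (2 * Q)))\<^sup>2 = - 1 / Q"
      using Q by (simp add: divide_simps)
    ultimately show ?thesis
      by (simp only: gauss_def normal_density_def Q_def) simp
  qed
  then have "ln (gauss \<theta> x) = ln (- Q / pi) / 2 + Q * (x + fst \<theta> / (2 * Q))\<^sup>2"
    using Q pos by (simp add: ln_mult ln_sqrt)
  also have "Q * (x + fst \<theta> / (2 * Q))\<^sup>2 = fst \<theta> * x + Q * x\<^sup>2 + (fst \<theta>)\<^sup>2 / (4 * Q)"
    using Q by (simp add: field_simps power2_eq_square)
  finally show ?thesis by (simp add: Q_def)
qed

text \<open>The score is the sufficient statistic minus its expectation,
  \<open>fst v * (x - \<mu>) + snd v * (x^2 - \<mu>^2 - s)\<close>, rearranged in powers of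
  \<open>x - \<mu>\<close> so that central moments apply.\<close>

lemma score_eq:
  assumes Q: "snd \<theta> < 0"
  defines "\<mu> \<equiv> - fst \<theta> / (2 * snd \<theta>)" and "s \<equiv> - 1 / (2 * snd \<theta>)"
  shows "score \<theta> v x = (fst v + 2 * \<mu> * snd v) * (x - \<mu>) + snd v * ((x - \<mu>)\<^sup>2 - s)"
proof -
  let ?f = "\<lambda>\<eta>::real \<times> real. fst \<eta> * x + snd \<eta> * x\<^sup>2 + (fst \<eta>)\<^sup>2 / (4 * snd \<eta>) + ln (- snd \<eta> / pi) / 2"
  let ?D = "\<lambda>v::real \<times> real. (fst v + 2 * \<mu> * snd v) * (x - \<mu>) + snd v * ((x - \<mu>)\<^sup>2 - s)"
  have "(?f has_derivative ?D) (at \<theta>)"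
    using Q unfolding \<mu>_def s_def
    by (auto intro!: derivative_eq_intros simp: field_simps power2_eq_square divide_neg_pos)
  moreover have "open {\<theta>::real \<times> real. snd \<theta> < 0}"
    by (intro open_Collect_less continuous_intros)
  ultimately have "((\<lambda>\<eta>. ln (gauss \<eta> x)) has_derivative ?D) (at \<theta>)"
    by (rule has_derivative_transform_within_open) (use Q in \<open>simp_all add: ln_gauss\<close>)
  from fun_cong[OF frechet_derivative_at[OF this], of v] show ?thesis
    unfolding score_def by (rule sym)
qed

text \<open>A product of two scores is a quartic in \<open>x - \<mu>\<close>, and the central
  moments of order 0 to 4 are 1, 0, \<open>s\<close>, 0, \<open>3 * s^2\<close>. The coefficient 2
  of the last term is 3 - 2 + 1, from the moments of order 4, 2 and 0.\<close>

lemma fisher_eq: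
  assumes Q: "snd \<theta> < 0"
  defines "s \<equiv> - 1 / (2 * snd \<theta>)"
  shows "fisher \<theta> v w =
    s * (fst v + 2 * fst \<theta> * s * snd v) * (fst w + 2 * fst \<theta> * s * snd w) + 2 * s\<^sup>2 * snd v * snd w"
proof -
  define \<mu> where "\<mu> = - fst \<theta> / (2 * snd \<theta>)"
  define a b where "a = fst v + 2 * \<mu> * snd v" and "b = fst w + 2 * \<mu> * snd w"
  have s: "0 < s" using Q by (simp add: s_def divide_neg_pos)
  define \<sigma> where "\<sigma> = sqrt s"
  have \<sigma>: "0 < \<sigma>" "\<sigma>\<^sup>2 = s" using s by (auto simp: \<sigma>_def)
  define N where "N = (\<lambda>k x. normal_density \<mu> \<sigma> x * (x - \<mu>) ^ k)"
  \<comment> \<open>The even and odd moment formulas at index \<open>k\<close> concern the orders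
    \<open>2 * k\<close> and \<open>2 * k + 1\<close>.\<close>
  have N0: "has_bochner_integral lborel (N 0) 1"
    using normal_moment_even[OF \<sigma>(1), of \<mu> 0] by (simp add: N_def)
  have N1: "has_bochner_integral lborel (N 1) 0"
    using normal_moment_odd[OF \<sigma>(1), of \<mu> 0] by (simp add: N_def)
  have N2: "has_bochner_integral lborel (N 2) s"
    using normal_moment_even[OF \<sigma>(1), of \<mu> 1] by (simp add: N_def \<sigma>(2) fact_numeral)
  have N3: "has_bochner_integral lborel (N 3) 0"
    using normal_moment_odd[OF \<sigma>(1), of \<mu> 1] by (simp add: N_def numeral_3_eq_3)
  have N4: "has_bochner_integral lborel (N 4) (3 * s\<^sup>2)"
    using normal_moment_even[OF \<sigma>(1), of \<mu> 2]
    by (simp add: N_def \<sigma>(2) fact_numeral power_divide)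
  have gauss: "gauss \<theta> = normal_density \<mu> \<sigma>"
    by (simp add: gauss_def \<mu>_def \<sigma>_def s_def)
  have "score \<theta> v x * score \<theta> w x * gauss \<theta> x =
      snd v * snd w * N 4 x + (a * snd w + b * snd v) * N 3 x + (a * b - 2 * s * snd v * snd w) * N 2 x
      - s * (a * snd w + b * snd v) * N 1 x + s\<^sup>2 * snd v * snd w * N 0 x" for x
    unfolding score_eq[OF Q] \<mu>_def[symmetric] s_def[symmetric] a_def[symmetric] b_def[symmetric] gauss N_def
    by (simp add: algebra_simps power2_eq_square power3_eq_cube power4_eq_xxxx)
  moreover have "has_bochner_integral lborel (\<lambda>x. snd v * snd w * N 4 x + (a * snd w + b * snd v) * N 3 x
      + (a * b - 2 * s * snd v * snd w) * N 2 x
      - s * (a * snd w + b * snd v) * N 1 x + s\<^sup>2 * snd v * snd w * N 0 x)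
      (snd v * snd w * (3 * s\<^sup>2) + (a * snd w + b * snd v) * 0 + (a * b - 2 * s * snd v * snd w) * s
      - s * (a * snd w + b * snd v) * 0 + s\<^sup>2 * snd v * snd w * 1)"
    by (intro has_bochner_integral_add has_bochner_integral_diff has_bochner_integral_mult_right N0 N1 N2 N3 N4)
  ultimately have "fisher \<theta> v w = snd v * snd w * (3 * s\<^sup>2) + (a * b - 2 * s * snd v * snd w) * s
      + s\<^sup>2 * snd v * snd w"
    unfolding fisher_def by (simp add: has_bochner_integral_integral_eq)
  also have "\<dots> = s * a * b + 2 * s\<^sup>2 * snd v * snd w"
    by (simp add: algebra_simps power2_eq_square)
  finally have "fisher \<theta> v w = s * a * b + 2 * s\<^sup>2 * snd v * snd w" .
  moreover have "\<mu> = fst \<theta> * s" by (simp add: \<mu>_def s_def)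
  then have "a = fst v + 2 * fst \<theta> * s * snd v" "b = fst w + 2 * fst \<theta> * s * snd w"
    by (simp_all add: a_def b_def)
  ultimately show ?thesis by simp
qed

section \<open>The Kaehler metric of the tangent bundle\<close>

lemma TN_eq: "TN = {p. Re (snd p) < 0}"
  by (auto simp: TN_def natural_domain_eq)

lemma open_TN: "open TN"
  unfolding TN_eq by (intro open_Collect_less continuous_intros)

definition gauss_variance :: "complex \<times> complex \<Rightarrow> real" where
  "gauss_variance p = - 1 / (2 * Re (snd p))"

lemma gauss_variance_pos: "p \<in> TN \<Longrightarrow> 0 < gauss_variance p"
  by (simp add: TN_eq gauss_variance_def divide_neg_pos)

text \<open>Each \<open>Re (a * cnj b)\<close> merges a horizontal and a vertical product. The
  coefficients \<open>s\<close>, \<open>2 * P * s^2\<close> and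
  \<open>4 * P^2 * s^3 + 2 * s^2\<close> are the second derivatives of the log-partition
  function.\<close>

lemma TN_metric_eq:
  assumes "p \<in> TN"
  defines "s \<equiv> gauss_variance p" and "P \<equiv> Re (fst p)"
  shows "TN_metric p v w =
    s * Re (fst v * cnj (fst w)) + 2 * P * s\<^sup>2 * (Re (fst v * cnj (snd w)) + Re (snd v * cnj (fst w)))
    + (4 * P\<^sup>2 * s ^ 3 + 2 * s\<^sup>2) * Re (snd v * cnj (snd w))"
proof -
  have Q: "snd (Re (fst p), Re (snd p)) < 0" using assms(1) by (simp add: TN_eq)
  have s: "s = - 1 / (2 * snd (Re (fst p), Re (snd p)))" by (simp add: s_def gauss_variance_def)
  show ?thesis
    unfolding TN_metric_def Let_def fisher_eq[OF Q, folded s]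
    by (simp add: P_def algebra_simps power2_eq_square power3_eq_cube)
qed

lemma has_derivative_gauss_variance:
  assumes "p \<in> TN"
  shows "(gauss_variance has_derivative (\<lambda>u. 2 * (gauss_variance p)\<^sup>2 * Re (snd u))) (at p)"
  using assms unfolding TN_eq gauss_variance_def
  by (auto intro!: derivative_eq_intros simp: field_simps power2_eq_square)

text \<open>The third derivatives of the log-partition function appear here: 0,
  \<open>2 * s^2\<close>, \<open>8 * P * s^3\<close> and \<open>24 * P^2 * s^4 + 8 * s^3\<close> for
  the indices 111, 112, 122 and 222. The two middle values each occur twice, which is the symmetry
  wanted.\<close>

lemma has_derivative_TN_metric:
  assumes "p \<in> TN"
  defines "s \<equiv> gauss_variance p" and "P \<equiv> Re (fst p)"
  shows "((\<lambda>q. TN_metric q v w) has_derivative (\<lambda>u.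
      2 * s\<^sup>2 * Re (snd u) * Re (fst v * cnj (fst w))
    + (2 * s\<^sup>2 * Re (fst u) + 8 * P * s ^ 3 * Re (snd u)) * (Re (fst v * cnj (snd w)) + Re (snd v * cnj (fst w)))
    + (8 * P * s ^ 3 * Re (fst u) + (24 * P\<^sup>2 * s ^ 4 + 8 * s ^ 3) * Re (snd u)) * Re (snd v * cnj (snd w)))) (at p)"
proof -
  let ?s = gauss_variance
  have "((\<lambda>q. ?s q * Re (fst v * cnj (fst w))
    + 2 * Re (fst q) * (?s q)\<^sup>2 * (Re (fst v * cnj (snd w)) + Re (snd v * cnj (fst w)))
    + (4 * (Re (fst q))\<^sup>2 * ?s q ^ 3 + 2 * (?s q)\<^sup>2) * Re (snd v * cnj (snd w))) has_derivative (\<lambda>u.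
      2 * s\<^sup>2 * Re (snd u) * Re (fst v * cnj (fst w))
    + (2 * s\<^sup>2 * Re (fst u) + 8 * P * s ^ 3 * Re (snd u)) * (Re (fst v * cnj (snd w)) + Re (snd v * cnj (fst w)))
    + (8 * P * s ^ 3 * Re (fst u) + (24 * P\<^sup>2 * s ^ 4 + 8 * s ^ 3) * Re (snd u)) * Re (snd v * cnj (snd w)))) (at p)"
    unfolding s_def P_def
    by (rule has_derivative_gauss_variance[OF assms(1)] derivative_eq_intros refl)+
      (simp add: algebra_simps power2_eq_square power3_eq_cube power4_eq_xxxx)
  then show ?thesis
    by (rule has_derivative_transform_within_open[OF _ open_TN assms(1)]) (simp add: TN_metric_eq)
qed

lemma kaehler_TN: "kaehler TN TN_metric"
  unfolding kaehler_def
proof (intro conjI allI ballI impI)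
  show "open TN" by (rule open_TN)
  show "smooth_on TN (\<lambda>p. TN_metric p v w)" for v w
  proof (rule smooth_on_cong[OF _ open_TN TN_metric_eq[symmetric]])
    have "smooth_on TN gauss_variance"
      unfolding gauss_variance_def by (intro smooth_intros open_TN) (auto simp: TN_eq)
    then show "smooth_on TN (\<lambda>p. gauss_variance p * Re (fst v * cnj (fst w))
        + 2 * Re (fst p) * (gauss_variance p)\<^sup>2 * (Re (fst v * cnj (snd w)) + Re (snd v * cnj (fst w)))
        + (4 * (Re (fst p))\<^sup>2 * gauss_variance p ^ 3 + 2 * (gauss_variance p)\<^sup>2) * Re (snd v * cnj (snd w)))"
      by (intro smooth_intros open_TN)
  qed
next
  fix p assume p: "p \<in> TN"
  define s P where "s = gauss_variance p" and "P = Re (fst p)"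
  note eq = TN_metric_eq[OF p, folded s_def P_def]
  have s: "0 < s" using gauss_variance_pos[OF p] by (simp add: s_def)
  show "bilinear (TN_metric p)"
    unfolding bilinear_def eq by (auto intro!: linearI simp: algebra_simps)
  show "TN_metric p v w = TN_metric p w v" for v w
    unfolding eq by (simp add: algebra_simps)
  show "TN_metric p (cplx_str v) (cplx_str w) = TN_metric p v w" for v w
    unfolding eq by (simp add: cplx_str_def algebra_simps)
  show "0 < TN_metric p v v" if "v \<noteq> 0" for v
  proof -
    \<comment> \<open>Completing the square in \<open>fst v\<close>; \<open>2 * P * s\<close> is
      twice the mean.\<close>
    have "TN_metric p v v = s * (cmod (fst v + of_real (2 * P * s) * snd v))\<^sup>2 + 2 * s\<^sup>2 * (cmod (snd v))\<^sup>2"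
      unfolding eq cmod_power2 by (simp add: algebra_simps power2_eq_square power3_eq_cube)
    moreover have "0 < s * (cmod (fst v + of_real (2 * P * s) * snd v))\<^sup>2 + 2 * s\<^sup>2 * (cmod (snd v))\<^sup>2"
    proof (cases "snd v = 0")
      case True
      then have "fst v \<noteq> 0" using that by (auto simp: prod_eq_iff)
      with True s show ?thesis by simp
    next
      case False
      with s show ?thesis by (intro add_nonneg_pos) auto
    qed
    ultimately show ?thesis by simp
  qed
  \<comment> \<open>Only real parts of the direction enter the derivative, and the form is built
    from \<open>Im (a * cnj b)\<close>. Expanded into real and imaginary parts, the cyclic sum
    cancels in pairs because the third derivatives are symmetric.\<close>
  note D = frechet_derivative_at[OF has_derivative_TN_metric[OF p], symmetric]
  show "frechet_derivative (\<lambda>q. kaehler_form TN_metric q v w) (at p) u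
      + frechet_derivative (\<lambda>q. kaehler_form TN_metric q w u) (at p) v
      + frechet_derivative (\<lambda>q. kaehler_form TN_metric q u v) (at p) w = 0" for u v w
    unfolding kaehler_form_def D by (simp add: cplx_str_def algebra_simps)
qed

text \<open>A single \<open>L\<close> serves for all points, as the maps in question are
  affine.\<close>

lemma kaehler_isoI:
  assumes "smooth_map D D' f" "smooth_map D' D h"
    and "\<And>p. p \<in> D \<Longrightarrow> h (f p) = p" "\<And>q. q \<in> D' \<Longrightarrow> f (h q) = q"
    and "\<And>p. p \<in> D \<Longrightarrow> (f has_derivative L) (at p)"
    and "\<And>v. L (cplx_str v) = cplx_str (L v)"
    and "\<And>p v w. p \<in> D \<Longrightarrow> g' (f p) (L v) (L w) = g p v w"
  shows "kaehler_iso D g D' g' f"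
  using assms(6,7) diffeomorphismI[OF assms(1-4)]
  by (simp add: kaehler_iso_def Let_def frechet_derivative_at[OF assms(5), symmetric])

lemma homogeneous_kaehler_TN: "homogeneous_kaehler TN TN_metric"
  unfolding homogeneous_kaehler_def
proof (intro conjI ballI kaehler_TN)
  fix p q assume p: "p \<in> TN" and q: "q \<in> TN"
  \<comment> \<open>In the chart \<open>TN_to_HC\<close>, the map \<open>f\<close> below is
    \<open>(\<tau>, z) \<mapsto> (a\<^sup>2 \<tau> + b, a z + l \<tau> - m)\<close>, the action of an element of \<open>K0_affine\<close>.\<close>
  define a where "a = sqrt (Re (snd q) / Re (snd p))"
  define b where "b = Im (snd q) - a\<^sup>2 * Im (snd p)"
  define l where "l = (a * Re (fst p) - Re (fst q)) / Re (snd p)"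
  define m where "m = Im (fst q) - a * Im (fst p) + l * Im (snd p)"
  define f where "f = (\<lambda>w::complex \<times> complex. (of_real a * fst w - of_real l * snd w + \<i> * of_real m,
    of_real (a\<^sup>2) * snd w + \<i> * of_real b))"
  define h where "h = (\<lambda>w::complex \<times> complex. ((fst w + of_real l * ((snd w - \<i> * of_real b) / of_real (a\<^sup>2)) - \<i> * of_real m) / of_real a,
    (snd w - \<i> * of_real b) / of_real (a\<^sup>2)))"
  define L where "L = (\<lambda>w::complex \<times> complex. (of_real a * fst w - of_real l * snd w, of_real (a\<^sup>2) * snd w))"
  have a2: "a\<^sup>2 = Re (snd q) / Re (snd p)" and a: "0 < a"
    using p q by (auto simp: a_def TN_eq divide_neg_neg less_imp_le)
  \<comment> \<open>The four real equations of \<open>f p = q\<close> fix the parameters in turn: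
    real and imaginary part of the second coordinate give \<open>a\<close> and \<open>b\<close>,
    those of the first give \<open>l\<close> and \<open>m\<close>. The quotient under the root is
    positive because both real parts are negative.\<close>
  have "f p = q"
    using p a2 by (auto simp: f_def b_def l_def m_def TN_eq prod_eq_iff complex_eq_iff)
  moreover have "kaehler_iso TN TN_metric TN TN_metric f"
  proof (rule kaehler_isoI[where h = h and L = L])
    show "smooth_map TN TN f"
    proof (rule smooth_mapI[OF _ open_UNIV])
      show "f ` TN \<subseteq> TN" using a by (auto simp: f_def TN_eq mult_pos_neg)
      show "smooth_on UNIV f" unfolding f_def by (intro smooth_intros open_UNIV)
    qed auto
    show "smooth_map TN TN h"
    proof (rule smooth_mapI[OF _ open_UNIV])
      show "h ` TN \<subseteq> TN" using a by (auto simp: h_def TN_eq divide_neg_pos simp flip: of_real_power)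
      show "smooth_on UNIV h" unfolding h_def by (intro smooth_intros open_UNIV) (use a in auto)
    qed auto
    show "h (f w) = w" "f (h w) = w" for w
      using a by (simp_all add: f_def h_def prod_eq_iff)
    show "(f has_derivative L) (at w)" for w
      unfolding f_def L_def by (auto intro!: derivative_eq_intros)
    show "L (cplx_str v) = cplx_str (L v)" for v
      by (simp add: L_def cplx_str_def algebra_simps)
    fix w v v' assume w: "w \<in> TN"
    then have fw: "f w \<in> TN" using a by (simp add: f_def TN_eq mult_pos_neg)
    \<comment> \<open>On the base, \<open>f\<close> sends the variance \<open>s\<close> to
      \<open>s / a^2\<close> and the mean \<open>P * s\<close> to
      \<open>P * s / a + l / (2 * a^2)\<close>. This is the affine change
      \<open>x / a + l / (2 * a^2)\<close> of the sample variable, which explains why the Fisher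
      metric is preserved.\<close>
    define s P where "s = gauss_variance w" and "P = Re (fst w)"
    have s: "gauss_variance (f w) = s / a\<^sup>2"
      using w a by (simp add: gauss_variance_def s_def f_def TN_eq)
    have P: "Re (fst (f w)) = a * P + l / (2 * s)"
      using w by (simp add: f_def P_def s_def gauss_variance_def TN_eq)
    have "0 < s" using gauss_variance_pos[OF w] by (simp add: s_def)
    with a show "TN_metric (f w) (L v) (L v') = TN_metric w v v'"
      unfolding TN_metric_eq[OF fw] TN_metric_eq[OF w] s P s_def[symmetric] P_def[symmetric]
      by (simp add: L_def field_simps power2_eq_square power3_eq_cube)
  qed
  ultimately show "\<exists>f. kaehler_iso TN TN_metric TN TN_metric f \<and> f p = q" by blast
qed

section \<open>The Siegel-Jacobi space\<close>

lemma HC_eq: "HC = {p. 0 < Im (fst p)}"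
  by (auto simp: HC_def)

lemma open_HC: "open HC"
  unfolding HC_eq by (intro open_Collect_less continuous_intros)

lemma HC_metric_eq:
  fixes p :: "complex \<times> complex"
  defines "t \<equiv> Im (fst p)" and "y \<equiv> Im (snd p)"
  shows "HC_metric p v w = ((t + y\<^sup>2) / t ^ 3 * Re (fst v * cnj (fst w))
    - y / t\<^sup>2 * (Re (fst v * cnj (snd w)) + Re (snd v * cnj (fst w))) + 1 / t * Re (snd v * cnj (snd w))) / 2"
proof -
  \<comment> \<open>Naming the common diagonal entry keeps the fraction intact while the matrix
    product is expanded.\<close>
  define k where "k = (t + y\<^sup>2) / t ^ 3"
  show ?thesis
    unfolding HC_metric_def HC_matrix_def Let_def real_components_def t_def[symmetric] y_def[symmetric]
      k_def[symmetric]
    by (simp add: inner_vec_def matrix_vector_mult_def sum_4 vector_def algebra_simps)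
qed

text \<open>\<open>TN_to_HC\<close> is a complex linear involution, so it is its own derivative and
  \<open>h\<close> is the same formula.\<close>

lemma kaehler_iso_TN_to_HC: "kaehler_iso TN TN_metric HC HC_metric TN_to_HC"
proof (rule kaehler_isoI[where h = "\<lambda>w. (- \<i> * snd w, \<i> * fst w)" and L = TN_to_HC])
  have T: "TN_to_HC = (\<lambda>w. (- \<i> * snd w, \<i> * fst w))"
    by (auto simp: TN_to_HC_def)
  have s: "smooth_on UNIV TN_to_HC"
    unfolding T by (intro smooth_intros open_UNIV)
  show "smooth_map TN HC TN_to_HC"
    by (rule smooth_mapI[OF _ open_UNIV _ s]) (auto simp: T TN_eq HC_def)
  show "smooth_map HC TN (\<lambda>w. (- \<i> * snd w, \<i> * fst w))"
    by (rule smooth_mapI[OF _ open_UNIV _ s]) (auto simp: T TN_eq HC_def)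
  show "(TN_to_HC has_derivative TN_to_HC) (at p)" for p
    unfolding T by (auto intro!: derivative_eq_intros)
  show "TN_to_HC (cplx_str v) = cplx_str (TN_to_HC v)" for v
    by (simp add: T cplx_str_def)
  show "HC_metric (TN_to_HC p) (TN_to_HC v) (TN_to_HC w) = TN_metric p v w" if p: "p \<in> TN" for p v w
    unfolding TN_metric_eq[OF p] HC_metric_eq using p
    by (simp add: T TN_eq gauss_variance_def field_simps power2_eq_square power3_eq_cube)
qed (auto simp: TN_to_HC_def)

section \<open>Transitive actions and homogeneous spaces\<close>

text \<open>Bijectivity comes from the action of the inverse element. Extensionality turns the
  pointwise product law into the equality of functions that a homomorphism to
  \<open>BijGroup E\<close> requires.\<close>

lemma group_actionI:
  assumes "group G"
    and ext: "\<And>g. g \<in> carrier G \<Longrightarrow> \<phi> g \<in> extensional E"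
    and closed: "\<And>g x. \<lbrakk>g \<in> carrier G; x \<in> E\<rbrakk> \<Longrightarrow> \<phi> g x \<in> E"
    and one: "\<And>x. x \<in> E \<Longrightarrow> \<phi> \<one>\<^bsub>G\<^esub> x = x"
    and mult: "\<And>g h x. \<lbrakk>g \<in> carrier G; h \<in> carrier G; x \<in> E\<rbrakk> \<Longrightarrow> \<phi> (g \<otimes>\<^bsub>G\<^esub> h) x = \<phi> g (\<phi> h x)"
  shows "group_action G E \<phi>"
proof -
  interpret group G by fact
  have Bij: "\<phi> g \<in> Bij E" if "g \<in> carrier G" for g
  proof -
    have "bij_betw (\<phi> g) E E"
      by (rule bij_betw_byWitness[where f' = "\<phi> (inv\<^bsub>G\<^esub> g)"])
        (use that closed one mult[symmetric] in auto)
    with ext[OF that] show ?thesis by (simp add: Bij_def)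
  qed
  have "\<phi> (g \<otimes>\<^bsub>G\<^esub> h) = compose E (\<phi> g) (\<phi> h)" if "g \<in> carrier G" "h \<in> carrier G" for g h
    using that mult ext by (intro extensionalityI[of _ E]) (auto simp: compose_def)
  with Bij have "\<phi> \<in> hom G (BijGroup E)"
    by (auto simp: hom_def BijGroup_def)
  then show ?thesis
    by (simp add: group_action_def group_hom_def group_hom_axioms_def group_BijGroup \<open>group G\<close>)
qed

lemma transitive_actionI:
  assumes "group_action G E \<phi>" "p \<in> E"
    and from_p: "\<And>x. x \<in> E \<Longrightarrow> \<exists>g\<in>carrier G. \<phi> g p = x"
  shows "transitive_action G E \<phi>"
proof -
  interpret group_action G E \<phi> by fact
  interpret group G using group_hom by (rule group_hom.axioms)
  have "\<exists>g\<in>carrier G. \<phi> g x = y" if "x \<in> E" "y \<in> E" for x y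
  proof -
    obtain g h where g: "g \<in> carrier G" "\<phi> g p = x" and h: "h \<in> carrier G" "\<phi> h p = y"
      using from_p \<open>x \<in> E\<close> \<open>y \<in> E\<close> by metis
    then have "\<phi> (h \<otimes>\<^bsub>G\<^esub> inv\<^bsub>G\<^esub> g) x = y"
      using composition_rule[of x h "inv\<^bsub>G\<^esub> g"] orbit_sym_aux[OF g(1) \<open>p \<in> E\<close> g(2)] \<open>x \<in> E\<close> by simp
    with g h show ?thesis by (metis inv_closed m_closed)
  qed
  then show ?thesis by unfold_locales
qed

lemma smooth_map_cong:
  assumes "smooth_map S T f" "\<And>x. x \<in> S \<Longrightarrow> f x = g x"
  shows "smooth_map S T g"
  using assms unfolding smooth_map_def image_subset_iff by (metis IntE)

text \<open>The orbit-stabilizer bijection with smoothness added: the orbit map makes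
  \<open>F\<close> smooth, and a global smooth section \<open>s\<close> provides the lifts demanded
  of its inverse.\<close>

lemma quotient_identification_exists:
  assumes "group_action G M \<phi>" "p \<in> M"
    and orbit: "smooth_map (carrier G) M (\<lambda>g. \<phi> g p)"
    and sec: "smooth_map M (carrier G) s" "\<And>r. r \<in> M \<Longrightarrow> \<phi> (s r) p = r"
  shows "\<exists>F. quotient_identification G (stabilizer G \<phi> p) \<phi> M p F"
proof -
  interpret group_action G M \<phi> by fact
  interpret group G using group_hom by (rule group_hom.axioms)
  define H where "H = stabilizer G \<phi> p"
  have H: "subgroup H G" using stabilizer_subgroup[OF \<open>p \<in> M\<close>] by (simp add: H_def)
  then have HG: "H \<subseteq> carrier G" by (rule subgroup.subset)
  \<comment> \<open>The choice of representative is harmless: members of a coset differ by a right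
    factor fixing \<open>p\<close>.\<close>
  define F where "F C = \<phi> (SOME g. g \<in> C) p" for C
  have F: "F (g <#\<^bsub>G\<^esub> H) = \<phi> g p" if g: "g \<in> carrier G" for g
  proof -
    have "(SOME x. x \<in> g <#\<^bsub>G\<^esub> H) \<in> g <#\<^bsub>G\<^esub> H"
      using lcos_self[OF g H] by (rule someI)
    then obtain h where h: "h \<in> H" "(SOME x. x \<in> g <#\<^bsub>G\<^esub> H) = g \<otimes>\<^bsub>G\<^esub> h"
      by (auto simp: l_coset_def)
    then show ?thesis
      using composition_rule[OF \<open>p \<in> M\<close> g] by (auto simp: F_def H_def stabilizer_def)
  qed
  have sG: "s r \<in> carrier G" if "r \<in> M" for r
    using sec(1) that by (auto simp: smooth_map_def)
  have inj: "g <#\<^bsub>G\<^esub> H = h <#\<^bsub>G\<^esub> H" if "g \<in> carrier G" "h \<in> carrier G" "\<phi> g p = \<phi> h p" for g h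
  proof -
    have "\<phi> (inv\<^bsub>G\<^esub> g \<otimes>\<^bsub>G\<^esub> h) p = p"
      using that composition_rule[OF \<open>p \<in> M\<close>, of "inv\<^bsub>G\<^esub> g" h] orbit_sym_aux[OF _ \<open>p \<in> M\<close>, of g] by simp
    then have "inv\<^bsub>G\<^esub> g \<otimes>\<^bsub>G\<^esub> h \<in> H" using that by (simp add: H_def stabilizer_def)
    moreover have "h = g \<otimes>\<^bsub>G\<^esub> (inv\<^bsub>G\<^esub> g \<otimes>\<^bsub>G\<^esub> h)" using that by (simp add: m_assoc[symmetric])
    ultimately have "h \<in> g <#\<^bsub>G\<^esub> H" by (auto simp: l_coset_def)
    then show ?thesis using l_repr_independence that(1) H by blast
  qed
  have "quotient_identification G H \<phi> M p F"
    unfolding quotient_identification_def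
  proof (intro conjI ballI)
    show "bij_betw F (lcosets\<^bsub>G\<^esub> H) M"
      unfolding bij_betw_def
    proof
      show "inj_on F (lcosets\<^bsub>G\<^esub> H)"
      proof (rule inj_onI)
        fix C D assume "C \<in> lcosets\<^bsub>G\<^esub> H" "D \<in> lcosets\<^bsub>G\<^esub> H" and eq: "F C = F D"
        then obtain g h where "g \<in> carrier G" "h \<in> carrier G" "C = g <#\<^bsub>G\<^esub> H" "D = h <#\<^bsub>G\<^esub> H"
          by (auto simp: LCOSETS_def)
        with eq F inj show "C = D" by metis
      qed
      have "r \<in> F ` (lcosets\<^bsub>G\<^esub> H)" if "r \<in> M" for r
        using F[OF sG[OF that]] sec(2)[OF that] sG[OF that] by (force simp: LCOSETS_def)
      then show "F ` (lcosets\<^bsub>G\<^esub> H) = M"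
        using element_image[OF _ \<open>p \<in> M\<close>] by (auto simp: LCOSETS_def F)
    qed
    show "F H = p"
      using F[OF one_closed] id_eq_one \<open>p \<in> M\<close> lcos_mult_one[OF HG] by (metis restrict_apply')
    show "F (g <#\<^bsub>G\<^esub> C) = \<phi> g (F C)" if "g \<in> carrier G" "C \<in> lcosets\<^bsub>G\<^esub> H" for g C
      using that composition_rule[OF \<open>p \<in> M\<close>] by (auto simp: LCOSETS_def lcos_m_assoc[OF HG] F)
    show "smooth_map (carrier G) M (\<lambda>g. F (g <#\<^bsub>G\<^esub> H))"
      by (rule smooth_map_cong[OF orbit]) (simp add: F)
    fix q assume "q \<in> M"
    then show "\<exists>U s. open U \<and> q \<in> U \<and> smooth_map (M \<inter> U) (carrier G) s \<and>
        (\<forall>r\<in>M \<inter> U. F (s r <#\<^bsub>G\<^esub> H) = r)"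
      using sec sG F by (intro exI[of _ UNIV] exI[of _ s]) auto
  qed
  then show ?thesis unfolding H_def by blast
qed

lemma lie_isomorphicI:
  assumes "f \<in> hom G H" "smooth_map (carrier G) (carrier H) f" "smooth_map (carrier H) (carrier G) h"
    and "\<And>x. x \<in> carrier G \<Longrightarrow> h (f x) = x" "\<And>y. y \<in> carrier H \<Longrightarrow> f (h y) = y"
  shows "lie_isomorphic G H"
  using diffeomorphismI[OF assms(2-5)] assms(1)
  unfolding lie_isomorphic_def iso_def diffeomorphism_def by blast

section \<open>The groups and their isotropy subgroups\<close>

lemmas mat2_simps = vec_eq_iff forall_2 matrix_matrix_mult_def vector_matrix_mult_def sum_2 mat_def

lemma SL2_mult: "\<lbrakk>M \<in> SL2; N \<in> SL2\<rbrakk> \<Longrightarrow> M ** N \<in> SL2"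
  by (simp add: SL2_def det_mul)

lemma SL2_one: "mat 1 \<in> SL2"
  by (simp add: SL2_def)

lemma SL2_left_inverse:
  assumes "M \<in> SL2"
  obtains N where "N \<in> SL2" "N ** M = mat 1"
proof
  show "vector [vector [M$2$2, - M$1$2], vector [- M$2$1, M$1$1]] \<in> SL2"
    using assms by (simp add: SL2_def det_2 algebra_simps)
  show "vector [vector [M$2$2, - M$1$2], vector [- M$2$1, M$1$1]] ** M = mat 1"
    using assms by (simp add: SL2_def det_2 mat2_simps algebra_simps)
qed

text \<open>\<open>Omega\<close> is the determinant with rows \<open>X\<close> and \<open>Y\<close>,
  so \<open>M\<close> scales it by \<open>det M\<close>.\<close>

lemma Omega_mult_SL2: "M \<in> SL2 \<Longrightarrow> Omega (X v* M) (Y v* M) = Omega X Y"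
proof -
  have "Omega (X v* M) (Y v* M) = det M * Omega X Y"
    by (simp add: Omega_def vector_matrix_mult_def sum_2 det_2 algebra_simps)
  then show "M \<in> SL2 \<Longrightarrow> ?thesis" by (simp add: SL2_def)
qed

lemma Omega_add: "Omega (X + Y) Z = Omega X Z + Omega Y Z" "Omega X (Y + Z) = Omega X Y + Omega X Z"
  by (simp_all add: Omega_def algebra_simps)

lemma group_ASp2: "group ASp2"
proof (rule groupI)
  fix g assume "g \<in> carrier ASp2"
  then obtain M X where g: "g = (M, X)" "M \<in> SL2" by (auto simp: ASp2_def)
  then obtain N where "N \<in> SL2" "N ** M = mat 1" using SL2_left_inverse by blast
  moreover have "(- (X v* N)) v* M + X = 0"
    using \<open>N ** M = mat 1\<close> vector_matrix_left_distrib[of "- (X v* N)" "X v* N" M]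
    by (simp add: vector_matrix_mul_assoc eq_neg_iff_add_eq_0)
  ultimately show "\<exists>h\<in>carrier ASp2. h \<otimes>\<^bsub>ASp2\<^esub> g = \<one>\<^bsub>ASp2\<^esub>"
    by (intro bexI[of _ "(N, - (X v* N))"]) (auto simp: ASp2_def g)
qed (auto simp: ASp2_def SL2_mult SL2_one matrix_mul_assoc vector_matrix_mul_assoc vector_matrix_left_distrib add.assoc)

text \<open>Associativity in the last component is the cocycle identity for \<open>Omega\<close>,
  from additivity and \<open>SL2\<close>-invariance. The inverse has last component
  \<open>- k\<close> because \<open>Omega\<close> vanishes on parallel vectors.\<close>

lemma group_jacobi_group: "group jacobi_group"
proof (rule groupI)
  fix g assume "g \<in> carrier jacobi_group"
  then obtain M X k where g: "g = (M, X, k)" "M \<in> SL2" by (auto simp: jacobi_group_def)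
  then obtain N where N: "N \<in> SL2" "N ** M = mat 1" using SL2_left_inverse by blast
  have "(- (X v* N)) v* M = - X"
    using \<open>N ** M = mat 1\<close> vector_matrix_left_distrib[of "- (X v* N)" "X v* N" M]
    by (simp add: vector_matrix_mul_assoc eq_neg_iff_add_eq_0)
  moreover have "Omega (- X) X = 0" by (simp add: Omega_def)
  ultimately show "\<exists>h\<in>carrier jacobi_group. h \<otimes>\<^bsub>jacobi_group\<^esub> g = \<one>\<^bsub>jacobi_group\<^esub>"
    using N by (intro bexI[of _ "(N, - (X v* N), - k)"]) (auto simp: jacobi_group_def g)
qed (auto simp: jacobi_group_def SL2_mult SL2_one matrix_mul_assoc vector_matrix_mul_assoc[symmetric]
    vector_matrix_left_distrib add.assoc Omega_add Omega_mult_SL2 Omega_def[of _ 0] Omega_def[of 0])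

lemma K0_subset_SL2: "K0 \<subseteq> SL2"
  by (auto simp: K0_def SL2_def det_2)

lemma K0_eq: "K0 = {M. 0 < M$1$1 \<and> M$2$1 = 0 \<and> M$2$2 = 1 / M$1$1}"
proof (intro equalityI subsetI)
  fix M :: "real^2^2" assume M: "M \<in> {M. 0 < M$1$1 \<and> M$2$1 = 0 \<and> M$2$2 = 1 / M$1$1}"
  then have "M = vector [vector [M$1$1, M$1$2], vector [0, 1 / M$1$1]]"
    by (simp add: vec_eq_iff forall_2)
  with M show "M \<in> K0" unfolding K0_def by blast
qed (auto simp: K0_def)

text \<open>Closure under inverses is read off entrywise from \<open>M ** N = mat 1\<close>: a
  triangular \<open>M\<close> forces \<open>N\<close> to be triangular with reciprocal
  diagonal.\<close>

lemma group_K0_affine: "group K0_affine"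
proof -
  interpret group ASp2 by (rule group_ASp2)
  have "subgroup (K0 \<times> UNIV) ASp2"
  proof (rule subgroupI)
    show "K0 \<times> UNIV \<subseteq> carrier ASp2" using K0_subset_SL2 by (auto simp: ASp2_def)
    have "mat 1 \<in> K0" by (simp add: K0_eq mat_def)
    then show "K0 \<times> (UNIV :: (real^2) set) \<noteq> {}" by blast
    show "g \<otimes>\<^bsub>ASp2\<^esub> h \<in> K0 \<times> UNIV" if "g \<in> K0 \<times> UNIV" "h \<in> K0 \<times> UNIV" for g h
      using that by (auto simp: ASp2_def K0_eq matrix_matrix_mult_def sum_2)
    fix g assume g: "g \<in> K0 \<times> (UNIV :: (real^2) set)"
    then obtain M X where gM: "g = (M, X)" and M: "M \<in> K0" by auto
    obtain N Y where N: "inv\<^bsub>ASp2\<^esub> g = (N, Y)" by fastforce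
    have "g \<in> carrier ASp2" using g K0_subset_SL2 by (auto simp: ASp2_def)
    then have "M ** N = mat 1" using r_inv[OF \<open>g \<in> carrier ASp2\<close>, unfolded N, unfolded gM] by (simp add: ASp2_def)
    then have N': "N$2$1 = 0" "M$1$1 * N$1$1 = 1" "M$2$2 * N$2$2 = 1"
      using M by (auto simp: mat2_simps K0_eq)
    have pos: "0 < M$1$1" "M$2$2 = 1 / M$1$1" using M by (auto simp: K0_eq)
    have "N$2$2 = M$1$1" using N'(3) pos(1) unfolding pos(2) by simp
    moreover have "N$1$1 = 1 / M$1$1" using N'(2) pos by (simp add: field_simps)
    ultimately show "inv\<^bsub>ASp2\<^esub> g \<in> K0 \<times> UNIV"
      using N'(1) pos by (simp add: N K0_eq)
  qed
  then show ?thesis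
    unfolding K0_affine_def by (rule subgroup.subgroup_is_group) (rule group_ASp2)
qed

section \<open>The affine Moebius action on the Siegel-Jacobi space\<close>

lemma automorphy_factor_nonzero:
  assumes "M \<in> SL2" "0 < Im \<tau>"
  shows "of_real (M$2$1) * \<tau> + of_real (M$2$2) \<noteq> 0"
proof
  assume "of_real (M$2$1) * \<tau> + of_real (M$2$2) = 0"
  then have "M$2$1 * Im \<tau> = 0" "M$2$1 * Re \<tau> + M$2$2 = 0"
    by (simp_all add: complex_eq_iff)
  with assms show False by (simp add: SL2_def det_2)
qed

text \<open>\<open>Im (n / d)\<close> has the sign of \<open>Im (n * cnj d)\<close>, which equals
  \<open>det M * Im \<tau>\<close>.\<close>

lemma affine_moebius_closed:
  assumes "M \<in> SL2" "p \<in> HC"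
  shows "affine_moebius (M, X) p \<in> HC"
proof -
  obtain \<tau> z where p: "p = (\<tau>, z)" "0 < Im \<tau>" using assms by (auto simp: HC_def)
  define n d where "n = of_real (M$1$1) * \<tau> + of_real (M$1$2)"
    and "d = of_real (M$2$1) * \<tau> + of_real (M$2$2)"
  have "Im (n * cnj d) = det M * Im \<tau>"
    by (simp add: n_def d_def det_2 algebra_simps)
  then have "0 < Im (n / d)"
    using assms p by (simp add: Im_complex_div_gt_0 SL2_def)
  then show ?thesis by (simp add: p affine_moebius_def HC_def n_def d_def)
qed

text \<open>The cocycle relation of automorphy factors: \<open>D\<close> is the factor of
  \<open>M ** N\<close> at \<tau>, and \<open>D / j\<close> that of \<open>M\<close> at the image of
  \<tau> under \<open>N\<close>. The common denominator \<open>j\<close> then cancels.\<close>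

lemma affine_moebius_mult:
  assumes "N \<in> SL2" "p \<in> HC"
  shows "affine_moebius (M ** N, X v* N + Y) p = affine_moebius (M, X) (affine_moebius (N, Y) p)"
proof -
  obtain \<tau> z where p: "p = (\<tau>, z)" "0 < Im \<tau>" using assms by (auto simp: HC_def)
  define j where "j = of_real (N$2$1) * \<tau> + of_real (N$2$2)"
  define n where "n = of_real (N$1$1) * \<tau> + of_real (N$1$2)"
  have j: "j \<noteq> 0" unfolding j_def by (rule automorphy_factor_nonzero[OF assms(1) p(2)])
  define D where "D = of_real (M$2$1) * n + of_real (M$2$2) * j"
  have 1: "of_real (M$2$1) * (n / j) + of_real (M$2$2) = D / j"
    "of_real (M$1$1) * (n / j) + of_real (M$1$2) = (of_real (M$1$1) * n + of_real (M$1$2) * j) / j"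
    "(z + of_real (Y$1) * \<tau> + of_real (Y$2)) / j + of_real (X$1) * (n / j) + of_real (X$2) =
      (z + of_real (Y$1) * \<tau> + of_real (Y$2) + of_real (X$1) * n + of_real (X$2) * j) / j"
    using j by (simp_all add: D_def field_simps)
  have 2: "of_real ((M ** N)$2$1) * \<tau> + of_real ((M ** N)$2$2) = D"
    "of_real ((M ** N)$1$1) * \<tau> + of_real ((M ** N)$1$2) = of_real (M$1$1) * n + of_real (M$1$2) * j"
    "z + of_real ((X v* N + Y)$1) * \<tau> + of_real ((X v* N + Y)$2) =
      z + of_real (Y$1) * \<tau> + of_real (Y$2) + of_real (X$1) * n + of_real (X$2) * j"
    by (simp_all add: D_def n_def j_def matrix_matrix_mult_def vector_matrix_mult_def sum_2 algebra_simps)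
  show ?thesis
    unfolding p affine_moebius_def prod.case 2 n_def[symmetric] j_def[symmetric] 1
    using j by simp
qed

lemma ASp2_action_closed: "\<lbrakk>M \<in> SL2; p \<in> HC\<rbrakk> \<Longrightarrow> ASp2_action (M, X) p \<in> HC"
  by (simp add: ASp2_action_def affine_moebius_closed)

lemma ASp2_action_mult:
  "\<lbrakk>N \<in> SL2; p \<in> HC\<rbrakk> \<Longrightarrow> ASp2_action (M ** N, X v* N + Y) p = ASp2_action (M, X) (ASp2_action (N, Y) p)"
  by (simp add: ASp2_action_def affine_moebius_mult affine_moebius_closed)

lemma ASp2_action_one: "p \<in> HC \<Longrightarrow> ASp2_action (mat 1, 0) p = p"
  by (auto simp: ASp2_action_def affine_moebius_def mat_def split: prod.splits)

lemma ASp2_action_extensional: "ASp2_action g \<in> extensional HC"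
  by (simp add: ASp2_action_def)

lemma group_action_ASp2: "group_action ASp2 HC ASp2_action"
  by (rule group_actionI[OF group_ASp2])
    (auto simp: ASp2_def ASp2_action_extensional ASp2_action_closed ASp2_action_mult ASp2_action_one)

lemma group_action_jacobi_group: "group_action jacobi_group HC jacobi_action"
  by (rule group_actionI[OF group_jacobi_group])
    (auto simp: jacobi_group_def jacobi_action_def ASp2_action_extensional ASp2_action_closed
      ASp2_action_mult ASp2_action_one)

lemma group_action_K0_affine: "group_action K0_affine HC ASp2_action"
  by (rule group_actionI[OF group_K0_affine])
    (use K0_subset_SL2 in \<open>auto simp: K0_affine_def ASp2_def ASp2_action_extensional ASp2_action_closed
      ASp2_action_mult ASp2_action_one subset_iff\<close>)

section \<open>The orbit map at the base point and its smooth section\<close>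

text \<open>The inverse of the orbit map of \<^const>\<open>K0_affine\<close> at \<^const>\<open>base_point\<close>.\<close>

definition siegel_section :: "complex \<times> complex \<Rightarrow> (real^2^2) \<times> (real^2)" where
  "siegel_section p = (let r = sqrt (Im (fst p)) in
     (vector [vector [r, Re (fst p) / r], vector [0, 1 / r]], vector [Im (snd p) / r, Re (snd p) / r]))"

lemma base_point_in_HC: "base_point \<in> HC"
  by (simp add: base_point_def HC_def)

lemma ASp2_action_base_point:
  "ASp2_action (M, X) base_point =
    ((of_real (M$1$1) * \<i> + of_real (M$1$2)) / (of_real (M$2$1) * \<i> + of_real (M$2$2)),
     (of_real (X$1) * \<i> + of_real (X$2)) / (of_real (M$2$1) * \<i> + of_real (M$2$2)))"
  using base_point_in_HC by (simp add: ASp2_action_def affine_moebius_def base_point_def)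

lemma siegel_section_K0: "p \<in> HC \<Longrightarrow> siegel_section p \<in> K0 \<times> UNIV"
  by (simp add: siegel_section_def Let_def K0_eq HC_eq)

lemma siegel_section_SL2: "p \<in> HC \<Longrightarrow> siegel_section p \<in> SL2 \<times> UNIV"
  using siegel_section_K0[of p] K0_subset_SL2 by auto

lemma ASp2_action_siegel_section:
  assumes "p \<in> HC"
  shows "ASp2_action (siegel_section p) base_point = p"
proof -
  define r where "r = sqrt (Im (fst p))"
  have r: "r \<noteq> 0" "r * r = Im (fst p)" using assms by (auto simp: r_def HC_eq)
  \<comment> \<open>Both coordinates have this shape: \<open>c = 1\<close>,
    \<open>d = Re (fst p)\<close> in the first, and \<open>c = Im (snd p) / (r * r)\<close>,
    \<open>d = Re (snd p)\<close> in the second.\<close>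
  have *: "(of_real (c * r) * \<i> + of_real (d / r)) / (of_real 0 * \<i> + of_real (1 / r)) =
      of_real (c * (r * r)) * \<i> + of_real d" for c d
  proof -
    have "complex_of_real r \<noteq> 0" using r(1) by simp
    then show ?thesis by (simp add: distrib_left mult_ac)
  qed
  have "ASp2_action (siegel_section p) base_point =
      (of_real (1 * (r * r)) * \<i> + of_real (Re (fst p)),
       of_real (Im (snd p) / (r * r) * (r * r)) * \<i> + of_real (Re (snd p)))"
    unfolding siegel_section_def Let_def r_def[symmetric] ASp2_action_base_point *[symmetric]
    using r(1) by simp
  also have "\<dots> = p"
  proof -
    have "Im (snd p) / (r * r) * (r * r) = Im (snd p)" using r(1) by simp
    then show ?thesis
      unfolding r(2) by (simp add: prod_eq_iff complex_eq_iff)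
  qed
  finally show ?thesis .
qed

text \<open>The orbit point is \<open>(a^2 * \<i> + a * b, a * (X$1 * \<i> + X$2))\<close>, and
  positivity of \<open>a\<close> recovers it as the root of \<open>a^2\<close>. With the preceding
  lemma this is simple transitivity.\<close>

lemma siegel_section_ASp2_action:
  assumes "M \<in> K0"
  shows "siegel_section (ASp2_action (M, X) base_point) = (M, X)"
proof -
  define a b where "a = M$1$1" and "b = M$1$2"
  have a: "0 < a" "M$2$1 = 0" "M$2$2 = 1 / a" using assms by (auto simp: K0_eq a_def)
  have "Im (fst (ASp2_action (M, X) base_point)) = a\<^sup>2" "Re (fst (ASp2_action (M, X) base_point)) = a * b"
    "Im (snd (ASp2_action (M, X) base_point)) = a * X$1" "Re (snd (ASp2_action (M, X) base_point)) = a * X$2"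
    using a by (simp_all add: ASp2_action_base_point a_def[symmetric] b_def[symmetric] power2_eq_square)
  with a show ?thesis
    by (simp add: siegel_section_def Let_def vec_eq_iff forall_2 a_def b_def)
qed

lemma smooth_siegel_section: "smooth_on HC siegel_section"
  unfolding siegel_section_def Let_def
  by (intro smooth_intros open_HC) (auto simp: HC_eq)

text \<open>Off \<open>SL2\<close> the denominator may vanish, so the extension lives on the open
  set \<open>U\<close> where it does not. The parameter \<open>f\<close> covers the Jacobi group
  too, whose last coordinate is dropped before acting.\<close>

lemma smooth_orbit_map:
  fixes f :: "'a::euclidean_space \<Rightarrow> (real^2^2) \<times> (real^2)"
  assumes "smooth_on UNIV f" and SL2: "\<And>x. x \<in> S \<Longrightarrow> fst (f x) \<in> SL2"
  shows "smooth_map S HC (\<lambda>x. ASp2_action (f x) base_point)"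
proof -
  define M X where "M = (\<lambda>x. fst (f x))" and "X = (\<lambda>x. snd (f x))"
  define d where "d x = complex_of_real (M x$2$1) * \<i> + of_real (M x$2$2)" for x
  define U where "U = {x. d x \<noteq> 0}"
  have orbit: "ASp2_action (f x) base_point =
      ((of_real (M x$1$1) * \<i> + of_real (M x$1$2)) / d x, (of_real (X x$1) * \<i> + of_real (X x$2)) / d x)" for x
    using ASp2_action_base_point[of "M x" "X x"] by (simp add: M_def X_def d_def)
  have sm: "smooth_on UNIV M" "smooth_on UNIV X"
    unfolding M_def X_def by (intro smooth_intros assms open_UNIV)+
  then have "smooth_on UNIV d"
    unfolding d_def by (intro smooth_intros open_UNIV)
  then have "C_k_on 0 UNIV d"
    unfolding smooth_on_def by blast
  then have "continuous_on UNIV d" by simp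
  then have U: "open U" unfolding U_def by (intro open_Collect_neq continuous_on_const)
  show ?thesis
  proof (rule smooth_mapI[OF _ U])
    show "(\<lambda>x. ASp2_action (f x) base_point) ` S \<subseteq> HC"
    proof (intro image_subsetI)
      show "ASp2_action (f x) base_point \<in> HC" if "x \<in> S" for x
        using ASp2_action_closed[OF SL2[OF that] base_point_in_HC, of "snd (f x)"] by simp
    qed
    show "S \<subseteq> U"
      using SL2 automorphy_factor_nonzero[of _ \<i>] by (auto simp: U_def d_def M_def)
    show "smooth_on U (\<lambda>x. ASp2_action (f x) base_point)"
      unfolding orbit
      by (intro smooth_intros U smooth_on_subset[OF sm(1) U subset_UNIV] smooth_on_subset[OF sm(2) U subset_UNIV]
          smooth_on_subset[OF \<open>smooth_on UNIV d\<close> U subset_UNIV]) (auto simp: U_def)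
  qed simp
qed

section \<open>Isotropy at the base point\<close>

lemma rotation_matrix_2_iff:
  "rotation_matrix (M :: real^2^2) \<longleftrightarrow> det M = 1 \<and> M$1$1 = M$2$2 \<and> M$1$2 = - M$2$1"
proof
  assume "rotation_matrix M"
  then have "det M = 1" and o: "transpose M ** M = mat 1"
    by (simp_all add: rotation_matrix_def orthogonal_matrix)
  \<comment> \<open>The left side is the sum of the squared entries minus \<open>2 * det M\<close>,
    that is 2 - 2.\<close>
  have "(M$1$1 - M$2$2)\<^sup>2 + (M$1$2 + M$2$1)\<^sup>2 = 0"
    using o \<open>det M = 1\<close> by (simp add: mat2_simps transpose_def det_2 power2_eq_square algebra_simps)
  with \<open>det M = 1\<close> show "det M = 1 \<and> M$1$1 = M$2$2 \<and> M$1$2 = - M$2$1"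
    by (simp add: sum_power2_eq_zero_iff)
next
  assume M: "det M = 1 \<and> M$1$1 = M$2$2 \<and> M$1$2 = - M$2$1"
  then have e: "M$1$1 = M$2$2" "M$1$2 = - M$2$1" and "M$1$1 * M$2$2 - M$1$2 * M$2$1 = 1"
    unfolding det_2 by blast+
  then have "M$2$1 * M$2$1 + M$2$2 * M$2$2 = 1" unfolding e by simp
  with M show "rotation_matrix M"
    by (simp add: rotation_matrix_def orthogonal_matrix mat2_simps transpose_def det_2 algebra_simps)
qed

text \<open>Clearing the nonzero automorphy factor leaves two complex equations, whose real and
  imaginary parts are the entrywise conditions for a rotation and \<open>X = 0\<close>.\<close>

lemma ASp2_action_fixes_base_point_iff:
  assumes "M \<in> SL2"
  shows "ASp2_action (M, X) base_point = base_point \<longleftrightarrow> rotation_matrix M \<and> X = 0"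
proof -
  have "of_real (M$2$1) * \<i> + of_real (M$2$2) \<noteq> (0::complex)"
    by (rule automorphy_factor_nonzero[OF assms]) simp
  then have "ASp2_action (M, X) base_point = base_point \<longleftrightarrow>
      of_real (M$1$1) * \<i> + of_real (M$1$2) = \<i> * (of_real (M$2$1) * \<i> + of_real (M$2$2)) \<and>
      of_real (X$1) * \<i> + of_real (X$2) = (0::complex)"
    unfolding ASp2_action_base_point by (simp add: base_point_def divide_eq_eq)
  also have "\<dots> \<longleftrightarrow> M$1$1 = M$2$2 \<and> M$1$2 = - M$2$1 \<and> X = 0"
    by (auto simp: complex_eq_iff vec_eq_iff forall_2)
  finally show ?thesis
    using assms by (auto simp: rotation_matrix_2_iff SL2_def)
qed

lemma rotation_matrix_SL2: "rotation_matrix M \<Longrightarrow> M \<in> SL2"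
  by (simp add: rotation_matrix_def SL2_def)

lemma stabilizer_jacobi_group:
  "stabilizer jacobi_group jacobi_action base_point = {(M, 0, k) | M k. rotation_matrix M}"
  by (auto simp: stabilizer_def jacobi_group_def jacobi_action_def ASp2_action_fixes_base_point_iff
      rotation_matrix_SL2)

lemma stabilizer_ASp2:
  "stabilizer ASp2 ASp2_action base_point = {(M, 0) | M. rotation_matrix M}"
  by (auto simp: stabilizer_def ASp2_def ASp2_action_fixes_base_point_iff rotation_matrix_SL2)

text \<open>The diagonal entries are equal for a rotation, positive and reciprocal in
  \<open>K0\<close>; hence both are 1.\<close>

lemma stabilizer_K0_affine: "stabilizer K0_affine ASp2_action base_point = {\<one>\<^bsub>K0_affine\<^esub>}"
proof -
  have "M = mat 1" if "M \<in> K0" "rotation_matrix M" for M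
  proof -
    have "M$1$1 * M$2$2 = 1" "0 < M$1$1" using that(1) by (auto simp: K0_eq)
    moreover have "M$2$2 = M$1$1" using that(2) by (simp add: rotation_matrix_2_iff)
    ultimately have "M$1$1 = 1" by (simp add: power2_eq_square[symmetric] power2_eq_1_iff)
    with that show ?thesis by (simp add: K0_eq rotation_matrix_2_iff vec_eq_iff forall_2 mat_def)
  qed
  moreover have "mat 1 \<in> K0" by (simp add: K0_eq mat_def)
  moreover have "rotation_matrix (mat 1 :: real^2^2)"
    by (simp add: rotation_matrix_def orthogonal_matrix_id)
  ultimately have "M \<in> K0 \<and> ASp2_action (M, X) base_point = base_point \<longleftrightarrow> M = mat 1 \<and> X = 0" for M X
    using ASp2_action_fixes_base_point_iff[of M X] K0_subset_SL2 by blast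
  then show ?thesis
    by (auto simp: stabilizer_def K0_affine_def ASp2_def)
qed

text \<open>On the stabilizer \<open>X = 0\<close>, so the \<open>Omega\<close> term vanishes and
  the product becomes direct.\<close>

lemma lie_isomorphic_isotropy_jacobi_group:
  "lie_isomorphic (isotropy_group jacobi_group jacobi_action base_point) (SO2 \<times>\<times> real_add_group)"
proof (rule lie_isomorphicI[where f = "\<lambda>g. (fst g, snd (snd g))" and h = "\<lambda>g. (fst g, 0, snd g)"])
  show "(\<lambda>g. (fst g, snd (snd g))) \<in> hom (isotropy_group jacobi_group jacobi_action base_point) (SO2 \<times>\<times> real_add_group)"
    unfolding isotropy_group_def stabilizer_jacobi_group
    by (auto simp: hom_def SO2_def real_add_group_def DirProd_def jacobi_group_def Omega_def
        rotation_matrix_def orthogonal_matrix_mul det_mul)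
  show "smooth_map (carrier (isotropy_group jacobi_group jacobi_action base_point))
      (carrier (SO2 \<times>\<times> real_add_group)) (\<lambda>g. (fst g, snd (snd g)))"
    by (rule smooth_mapI[where U = UNIV and F = "\<lambda>g. (fst g, snd (snd g))"])
      (auto simp: isotropy_group_def stabilizer_jacobi_group SO2_def real_add_group_def intro!: smooth_intros)
  show "smooth_map (carrier (SO2 \<times>\<times> real_add_group))
      (carrier (isotropy_group jacobi_group jacobi_action base_point)) (\<lambda>g. (fst g, 0, snd g))"
    by (rule smooth_mapI[where U = UNIV and F = "\<lambda>g. (fst g, 0, snd g)"])
      (auto simp: isotropy_group_def stabilizer_jacobi_group SO2_def real_add_group_def intro!: smooth_intros)
qed (auto simp: isotropy_group_def stabilizer_jacobi_group)

lemma lie_isomorphic_isotropy_ASp2: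
  "lie_isomorphic (isotropy_group ASp2 ASp2_action base_point) SO2"
proof (rule lie_isomorphicI[where f = fst and h = "\<lambda>M. (M, 0)"])
  show "fst \<in> hom (isotropy_group ASp2 ASp2_action base_point) SO2"
    unfolding isotropy_group_def stabilizer_ASp2
    by (auto simp: hom_def SO2_def ASp2_def rotation_matrix_def orthogonal_matrix_mul det_mul)
  show "smooth_map (carrier (isotropy_group ASp2 ASp2_action base_point)) (carrier SO2) fst"
    by (rule smooth_mapI[where U = UNIV and F = "\<lambda>g. fst g"])
      (auto simp: isotropy_group_def stabilizer_ASp2 SO2_def intro!: smooth_intros)
  show "smooth_map (carrier SO2) (carrier (isotropy_group ASp2 ASp2_action base_point)) (\<lambda>M. (M, 0))"
    by (rule smooth_mapI[where U = UNIV and F = "\<lambda>M. (M, 0)"])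
      (auto simp: isotropy_group_def stabilizer_ASp2 SO2_def intro!: smooth_intros)
qed (auto simp: isotropy_group_def stabilizer_ASp2)

lemma trivial_isotropy_K0_affine: "trivial_group (isotropy_group K0_affine ASp2_action base_point)"
proof -
  have "group (isotropy_group K0_affine ASp2_action base_point)"
    unfolding isotropy_group_def
    by (rule subgroup.subgroup_is_group[OF
          group_action.stabilizer_subgroup[OF group_action_K0_affine base_point_in_HC] group_K0_affine])
  then show ?thesis
    by (simp add: trivial_group_def isotropy_group_def stabilizer_K0_affine)
qed

section \<open>Transitivity and the homogeneous space identifications\<close>

lemma transitive_ASp2: "transitive_action ASp2 HC ASp2_action"
proof (rule transitive_actionI[OF group_action_ASp2 base_point_in_HC])
  show "\<exists>g\<in>carrier ASp2. ASp2_action g base_point = p" if "p \<in> HC" for p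
    using siegel_section_SL2[OF that] ASp2_action_siegel_section[OF that]
    by (intro bexI[of _ "siegel_section p"]) (simp_all add: ASp2_def)
qed

lemma transitive_K0_affine: "transitive_action K0_affine HC ASp2_action"
proof (rule transitive_actionI[OF group_action_K0_affine base_point_in_HC])
  show "\<exists>g\<in>carrier K0_affine. ASp2_action g base_point = p" if "p \<in> HC" for p
    using siegel_section_K0[OF that] ASp2_action_siegel_section[OF that]
    by (intro bexI[of _ "siegel_section p"]) (simp_all add: K0_affine_def)
qed

lemma transitive_jacobi_group: "transitive_action jacobi_group HC jacobi_action"
proof (rule transitive_actionI[OF group_action_jacobi_group base_point_in_HC])
  show "\<exists>g\<in>carrier jacobi_group. jacobi_action g base_point = p" if "p \<in> HC" for p
    using siegel_section_SL2[OF that] ASp2_action_siegel_section[OF that]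
    by (intro bexI[of _ "(fst (siegel_section p), snd (siegel_section p), 0)"])
      (simp_all add: jacobi_group_def jacobi_action_def mem_Times_iff)
qed

text \<open>The last coordinate acts trivially, so the section of \<open>ASp2\<close> lifts with the
  value 0 there.\<close>

lemma quotient_identification_jacobi_group:
  "\<exists>F. quotient_identification jacobi_group (stabilizer jacobi_group jacobi_action base_point)
    jacobi_action HC base_point F"
proof (rule quotient_identification_exists[OF group_action_jacobi_group base_point_in_HC,
      where s = "\<lambda>p. (fst (siegel_section p), snd (siegel_section p), 0)"])
  have j: "jacobi_action g = ASp2_action (fst g, fst (snd g))" for g
    by (simp add: jacobi_action_def split: prod.split)
  show "smooth_map (carrier jacobi_group) HC (\<lambda>g. jacobi_action g base_point)"
    unfolding j
  proof (rule smooth_orbit_map)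
    show "smooth_on UNIV (\<lambda>g::(real^2^2) \<times> (real^2) \<times> real. (fst g, fst (snd g)))"
      by (intro smooth_intros open_UNIV)
  qed (auto simp: jacobi_group_def)
  show "jacobi_action (fst (siegel_section p), snd (siegel_section p), 0) base_point = p" if "p \<in> HC" for p
    using ASp2_action_siegel_section[OF that] by (simp add: j)
  show "smooth_map HC (carrier jacobi_group) (\<lambda>p. (fst (siegel_section p), snd (siegel_section p), 0))"
  proof (rule smooth_mapI[OF _ open_HC order.refl _ refl])
    show "(\<lambda>p. (fst (siegel_section p), snd (siegel_section p), 0)) ` HC \<subseteq> carrier jacobi_group"
      using siegel_section_SL2 by (simp add: jacobi_group_def image_subset_iff mem_Times_iff)
    show "smooth_on HC (\<lambda>p. (fst (siegel_section p), snd (siegel_section p), 0))"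
      by (intro smooth_intros smooth_siegel_section open_HC)
  qed
qed

lemma quotient_identification_ASp2:
  "\<exists>F. quotient_identification ASp2 (stabilizer ASp2 ASp2_action base_point) ASp2_action HC base_point F"
proof (rule quotient_identification_exists[OF group_action_ASp2 base_point_in_HC, where s = siegel_section])
  show "smooth_map (carrier ASp2) HC (\<lambda>g. ASp2_action g base_point)"
    by (rule smooth_orbit_map[OF smooth_on_ident[OF open_UNIV]]) (auto simp: ASp2_def)
  show "smooth_map HC (carrier ASp2) siegel_section"
    using siegel_section_SL2
    by (intro smooth_mapI[OF _ open_HC order.refl smooth_siegel_section refl]) (simp add: ASp2_def image_subset_iff)
qed (rule ASp2_action_siegel_section)

lemma group_identification_K0_affine:
  "group_identification K0_affine ASp2_action HC base_point (\<lambda>g. ASp2_action g base_point)"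
  unfolding group_identification_def
proof (intro conjI ballI)
  have c: "carrier K0_affine = K0 \<times> UNIV" by (simp add: K0_affine_def)
  show "diffeomorphism (carrier K0_affine) HC (\<lambda>g. ASp2_action g base_point)"
  proof (rule diffeomorphismI[where g = siegel_section])
    show "smooth_map (carrier K0_affine) HC (\<lambda>g. ASp2_action g base_point)"
      by (rule smooth_orbit_map[OF smooth_on_ident[OF open_UNIV]]) (use K0_subset_SL2 in \<open>auto simp: c\<close>)
    show "smooth_map HC (carrier K0_affine) siegel_section"
      using siegel_section_K0
      by (intro smooth_mapI[OF _ open_HC order.refl smooth_siegel_section refl]) (simp add: c image_subset_iff)
  qed (auto simp: c siegel_section_ASp2_action ASp2_action_siegel_section)
  show "ASp2_action \<one>\<^bsub>K0_affine\<^esub> base_point = base_point"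
    by (simp add: K0_affine_def ASp2_def ASp2_action_one base_point_in_HC)
  show "ASp2_action (g \<otimes>\<^bsub>K0_affine\<^esub> h) base_point = ASp2_action g (ASp2_action h base_point)"
    if "g \<in> carrier K0_affine" "h \<in> carrier K0_affine" for g h
    using that K0_subset_SL2 base_point_in_HC
    by (auto simp: c K0_affine_def ASp2_def ASp2_action_mult subset_iff)
qed

theorem proposition3p31:
  shows
    "kaehler_iso TN TN_metric HC HC_metric TN_to_HC \<and>
     (transitive_action jacobi_group HC jacobi_action \<and>
      transitive_action ASp2 HC ASp2_action \<and>
      transitive_action K0_affine HC ASp2_action) \<and>
     (lie_isomorphic (isotropy_group jacobi_group jacobi_action base_point)
        (SO2 \<times>\<times> real_add_group) \<and>
      lie_isomorphic (isotropy_group ASp2 ASp2_action base_point) SO2 \<and>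
      trivial_group (isotropy_group K0_affine ASp2_action base_point)) \<and>
     homogeneous_kaehler TN TN_metric \<and>
     (\<exists>F. quotient_identification jacobi_group (stabilizer jacobi_group jacobi_action base_point)
            jacobi_action HC base_point F) \<and>
     (\<exists>F. quotient_identification ASp2 (stabilizer ASp2 ASp2_action base_point)
            ASp2_action HC base_point F) \<and>
     (\<exists>F. group_identification K0_affine ASp2_action HC base_point F)"
  using kaehler_iso_TN_to_HC lie_isomorphic_isotropy_jacobi_group lie_isomorphic_isotropy_ASp2
    trivial_isotropy_K0_affine homogeneous_kaehler_TN quotient_identification_jacobi_group
    quotient_identification_ASp2 group_identification_K0_affine
    transitive_jacobi_group transitive_ASp2 transitive_K0_affine
  by blast

end
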